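(* Let $T>0$ and let $Y(t)=\sum_{i=1}^{N(t)}X_i\,h_i(t,T_i)$, $t\ge0$, be a shot noise process as described in the context, where $\{N(t)\}$ is an inhomogeneous Poisson process with intensity function $\lambda(\cdot)$, cumulative intensity function $m(\cdot)$ and points $T_1\le T_2\le\cdots$. Assume that, for some $\alpha>0$: (i) the nonnegative random variables $X_i$ are identically distributed with common mean $\gamma$, and $x\mapsto\mathbb{P}(X_1>x)$ is regularly varying at infinity with index $-\alpha$; (ii) $\displaystyle\sup_{i\neq j}\frac{\mathbb{P}(X_i>x,X_j>x)}{\mathbb{P}(X_1>x)}\to0$ as $x\to\infty$; (iii) the random functions $h_j(T,\cdot)$ are i.i.d., independent of the $T_j$'s, and integrable of order $p$ for some $p>\alpha$, i.e. $\mathbb{E}[h_0^{p}(T,V_0)]<\infty$. Then $$\lim_{x\to\infty}\frac{\mathbb{P}(Y(T)>x)}{\mathbb{P}(X_1>x)}=m(T)\,\mathbb{E}[h_0^{\alpha}(T,V_0)],$$ where $V_0$ is a random variable, independent of $h_0$, with density $\lambda(t)/m(T)$, $0\le t\le T$.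
   Context: The shocks $(X_i)_{i\ge1}$ are nonnegative random variables (not necessarily independent of each other); the shock functions $(h_i)$ are i.i.d. nonnegative measurable random functions $(t,s)\mapsto h_i(t,s)$, $h_0$ denoting a generic copy; the shock instants $(T_i)_{i\ge1}$ are the points of the Poisson process and $N(t)=\#\{i:T_i\le t\}$. The sequence $(X_i)$ is independent of the $(h_i)$ and of the $(T_i)$. Here $m(t)=\int_0^t\lambda(s)\,ds=\mathbb{E}[N(t)]$, with $0<m(T)<\infty$. $h_0^\alpha(t,s)$ means $(h_0(t,s))^\alpha$. *)

theory Defs
  imports "HOL-Probability.Probability"
begin

definition regularly_varying :: "(real \<Rightarrow> real) \<Rightarrow> real \<Rightarrow> bool" where
  "regularly_varying f \<rho> \<longleftrightarrow>
     (\<exists>a. set_borel_measurable borel {a..} f \<and> (\<forall>x\<ge>a. f x > 0)) \<and>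
     (\<forall>c>0. ((\<lambda>x. f (c * x) / f x) \<longlongrightarrow> c powr \<rho>) at_top)"

(* The library's indep_var requires both variables to have the same value type. *)
definition independent_rvs ::
  "'w measure \<Rightarrow> 'a measure \<Rightarrow> ('w \<Rightarrow> 'a) \<Rightarrow> 'b measure \<Rightarrow> ('w \<Rightarrow> 'b) \<Rightarrow> bool" where
  "independent_rvs M A f B g \<longleftrightarrow>
     f \<in> M \<rightarrow>\<^sub>M A \<and> g \<in> M \<rightarrow>\<^sub>M B \<and>
     prob_space.indep_set M
       {f -` S \<inter> space M | S. S \<in> sets A} {g -` S \<inter> space M | S. S \<in> sets B}"

(* Sequences are indexed by i >= 1; the values at index 0 are never used. *)
definition iid :: "'w measure \<Rightarrow> 'a measure \<Rightarrow> (nat \<Rightarrow> 'w \<Rightarrow> 'a) \<Rightarrow> bool" where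
  "iid M A Z \<longleftrightarrow>
     prob_space.indep_vars M (\<lambda>_. A) Z {1..} \<and> (\<forall>i\<ge>1. distr M A (Z i) = distr M A (Z 1))"

(* A nonnegative measurable random function is a random element of a measurable space F of
   nonnegative functions on which evaluation (f, x) |-> f x is jointly measurable. Laws and
   independence of random functions refer to the sigma-algebra of F. The sigma-algebra generated
   by the single evaluations would be too small: if U is uniform on [0, 1] and f s is 1 for s = U
   and 0 otherwise, then f is independent of U with respect to it although f U = 1.
   Functions given on a subset of the argument space are extended by 0. *)
definition nonneg_function_space :: "'a measure \<Rightarrow> ('a \<Rightarrow> real) measure \<Rightarrow> bool" where
  "nonneg_function_space S F \<longleftrightarrow>
     (\<forall>f\<in>space F. \<forall>x. 0 \<le> f x) \<and> (\<lambda>(f, x). f x) \<in> borel_measurable (F \<Otimes>\<^sub>M S)"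

definition cumulative_intensity :: "(real \<Rightarrow> real) \<Rightarrow> real \<Rightarrow> ennreal" where
  "cumulative_intensity lam t = (\<integral>\<^sup>+s. ennreal (lam s) * indicator {0..t} s \<partial>lborel)"

(* The i-th point is infinite if the process has fewer than i points. *)
definition point_count :: "(nat \<Rightarrow> 'w \<Rightarrow> ennreal) \<Rightarrow> real \<Rightarrow> 'w \<Rightarrow> nat" where
  "point_count pts t \<omega> = card {i. 1 \<le> i \<and> pts i \<omega> \<le> ennreal t}"

(* Inhomogeneous Poisson process with ordered points pts 1, pts 2, ... and intensity lam. The
   requirements concern the times t at which the cumulative intensity is finite; for a locally
   integrable intensity these are all t >= 0. The Poisson probabilities are written out because
   poisson_pmf is specified for positive rates only. *)
definition poisson_process ::
  "'w measure \<Rightarrow> (real \<Rightarrow> real) \<Rightarrow> (nat \<Rightarrow> 'w \<Rightarrow> ennreal) \<Rightarrow> bool" where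
  "poisson_process M lam pts \<longleftrightarrow>
     set_borel_measurable lborel {0..} lam \<and> (\<forall>t\<ge>0. 0 \<le> lam t) \<and>
     (\<forall>i\<ge>1. pts i \<in> borel_measurable M) \<and>
     (AE \<omega> in M. \<forall>i\<ge>1. pts i \<omega> \<le> pts (Suc i) \<omega>) \<and>
     (\<forall>t\<ge>0. cumulative_intensity lam t < \<infinity> \<longrightarrow>
        (AE \<omega> in M. finite {i. 1 \<le> i \<and> pts i \<omega> \<le> ennreal t})) \<and>
     (AE \<omega> in M. point_count pts 0 \<omega> = 0) \<and>
     (\<forall>s t. 0 \<le> s \<and> s \<le> t \<and> cumulative_intensity lam t < \<infinity> \<longrightarrow>
        (\<forall>k. measure M {\<omega> \<in> space M. point_count pts t \<omega> - point_count pts s \<omega> = k} =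
           (let r = enn2real (cumulative_intensity lam t - cumulative_intensity lam s)
            in r ^ k / fact k * exp (- r)))) \<and>
     (\<forall>n \<tau>. 0 \<le> \<tau> 0 \<and> (\<forall>k<n. \<tau> k \<le> \<tau> (Suc k)) \<and> cumulative_intensity lam (\<tau> n) < \<infinity> \<longrightarrow>
        prob_space.indep_vars M (\<lambda>_. count_space UNIV)
          (\<lambda>k \<omega>. point_count pts (\<tau> (Suc k)) \<omega> - point_count pts (\<tau> k) \<omega>) {..<n})"

definition shot_noise ::
  "(nat \<Rightarrow> 'w \<Rightarrow> real) \<Rightarrow> (nat \<Rightarrow> 'w \<Rightarrow> real \<times> real \<Rightarrow> real) \<Rightarrow> (nat \<Rightarrow> 'w \<Rightarrow> ennreal)
     \<Rightarrow> real \<Rightarrow> 'w \<Rightarrow> real" where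
  "shot_noise X h pts t \<omega> =
     (\<Sum>i = 1..point_count pts t \<omega>. X i \<omega> * h i \<omega> (t, enn2real (pts i \<omega>)))"

end

theory Submission
  imports Defs
begin

text \<open>
  Condition on the weights \<open>h\<^sub>i(T, T\<^sub>i)\<close> and on \<open>N(T)\<close>, which are jointly independent of the shocks.
  For fixed nonnegative weights, condition (ii) leaves only the event that a single term is large,
  so \<open>P(\<Sum> c\<^sub>i X\<^sub>i > x) / P(X\<^sub>1 > x)\<close> tends to \<open>\<Sum> c\<^sub>i\<^sup>\<alpha>\<close>. A Potter bound for the monotone tail
  dominates this ratio, uniformly in \<open>x\<close>, by a multiple of
  \<open>\<Sum>\<^bsub>i \<le> N(T)\<^esub> (1 + (N(T) h\<^sub>i(T, T\<^sub>i))\<^sup>p)\<close>. Given \<open>N(T) = n\<close>, the mean number of points in an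
  interval is \<open>n\<close> times its share of \<open>m(T)\<close>; by this Campbell formula the dominating sum is
  integrable and the limit has mean \<open>m(T) E[h\<^sub>0\<^sup>\<alpha>(T, V\<^sub>0)]\<close>.
\<close>

section \<open>Tails of weighted sums\<close>

text \<open>With \<open>n\<close> replaced by N(T), the dominating variable couples the number of
  points with their positions, so the plain formula for the mean of a sum over points does not
  suffice; it has to carry a weight g(N(T)). This is why the mean measure of the points is computed
  on each event N(T) = n. The weight then separates as the mean of g under the size-biased law n
  P(N(T) = n) / m(T), which has mass 1 and finite power moments. The weight g = 1 gives the limit,
  g(n) = n^p the integrability. The laws of the individual ordered points never appear: summation
  over all indices reduces everything to counts on half-lines. Evaluating a random function at an
  independent random time is Fubini for the two laws and rests on joint measurability of
  evaluation.\<close>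

lemma regularly_varying_potter_bound:
  fixes f :: "real \<Rightarrow> real"
  assumes rv: "regularly_varying f (- \<alpha>)" and anti: "antimono f" and le1: "\<And>x. f x \<le> 1"
    and p: "\<alpha> < p" "0 < p"
  obtains A x0 where "0 < A" "\<And>x. x0 \<le> x \<Longrightarrow> 0 < f x"
    "\<And>x c. x0 \<le> x \<Longrightarrow> 0 < c \<Longrightarrow> f (x / c) \<le> A * (1 + c powr p) * f x"
proof -
  obtain a where a: "\<And>x. x \<ge> a \<Longrightarrow> f x > 0"
    using rv unfolding regularly_varying_def by blast
  \<comment> \<open>The single factor 2 carries the whole bound. Since \<open>p\<close> exceeds
    \<alpha>, the limit 2^(-\<alpha>) lies above 2^(-p), so eventually each doubling of the argument
    costs at most a factor 2^p.\<close>
  have "((\<lambda>x. f (2 * x) / f x) \<longlongrightarrow> 2 powr (- \<alpha>)) at_top"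
    using rv unfolding regularly_varying_def by auto
  moreover have "(2::real) powr (- p) < 2 powr (- \<alpha>)"
    using p by simp
  ultimately have "eventually (\<lambda>x. 2 powr (- p) < f (2 * x) / f x) at_top"
    by (rule order_tendstoD(1))
  then obtain b where b: "\<And>x. x \<ge> b \<Longrightarrow> 2 powr (- p) < f (2 * x) / f x"
    unfolding eventually_at_top_linorder by blast
  \<comment> \<open>A value of at least 1 keeps \<open>x0\<close> positive: scaling by factors from
    1 upwards stays in the range, and division by \<open>x0\<close> is safe.\<close>
  define x0 where "x0 = max 1 (max a b)"
  have x0: "x0 \<ge> 1" "x0 \<ge> a" "x0 \<ge> b"
    by (auto simp: x0_def)
  have pos: "f x > 0" if "x \<ge> x0" for x
    using a that x0 by auto
  have doubling: "f x \<le> 2 powr p * f (2 * x)" if "x \<ge> x0" for x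
  proof -
    have "2 powr (- p) < f (2 * x) / f x"
      using b that x0 by auto
    then have "2 powr (- p) * f x \<le> f (2 * x)"
      using pos[OF that] by (simp add: field_simps)
    then show ?thesis
      by (simp add: powr_minus field_simps)
  qed
  have iterated: "f x \<le> (2 powr p) ^ k * f (2 ^ k * x)" if "x \<ge> x0" for x k
  proof (induction k)
    case (Suc k)
    have "x0 \<le> 2 ^ k * x"
      using that x0 mult_mono[of 1 "2 ^ k" x0 x] by auto
    then have "(2 powr p) ^ k * f (2 ^ k * x) \<le> (2 powr p) ^ k * (2 powr p * f (2 * (2 ^ k * x)))"
      by (intro mult_left_mono doubling) auto
    from order_trans[OF Suc this] show ?case
      by (simp add: mult_ac)
  qed simp
  have growth: "f y \<le> 2 powr p * d powr p * f (d * y)" if y: "y \<ge> x0" and d: "d \<ge> 1" for y d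
  proof -
    \<comment> \<open>The least number of doublings that covers the factor \<open>d\<close>.
      Rounding up costs at most one extra doubling, hence the prefactor 2^p; monotonicity then
      replaces 2^k by the smaller \<open>d\<close>.\<close>
    define k where "k = nat \<lceil>log 2 d\<rceil>"
    have log: "log 2 d \<ge> 0"
      using d by simp
    have k1: "log 2 d \<le> real k" and k2: "real k \<le> 1 + log 2 d"
      unfolding k_def using log by linarith+
    have "d = 2 powr (log 2 d)"
      using d by simp
    also have "\<dots> \<le> 2 powr (real k)"
      using k1 by simp
    finally have dk: "d \<le> 2 ^ k"
      by (simp add: powr_realpow)
    have "(2 powr p) ^ k = (2 powr real k) powr p"
      by (simp add: powr_realpow[symmetric] powr_powr mult.commute)
    also have "\<dots> \<le> (2 powr (1 + log 2 d)) powr p"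
      using k2 p by (intro powr_mono2) auto
    also have "\<dots> = 2 powr p * d powr p"
      using d by (simp add: powr_add powr_mult)
    finally have k3: "(2 powr p) ^ k \<le> 2 powr p * d powr p" .
    have dy: "x0 \<le> d * y"
      using y d x0 mult_mono[of 1 d x0 y] by auto
    have "f y \<le> (2 powr p) ^ k * f (2 ^ k * y)"
      using iterated[OF y] .
    also have "\<dots> \<le> (2 powr p) ^ k * f (d * y)"
      using dk y x0 by (intro mult_left_mono antimonoD[OF anti] mult_right_mono) auto
    also have "\<dots> \<le> 2 powr p * d powr p * f (d * y)"
      using k3 pos[OF dy] by (intro mult_right_mono) auto
    finally show ?thesis .
  qed
  \<comment> \<open>Division by \<open>f x0\<close> serves the arguments \<open>x / c\<close> below
    \<open>x0\<close>, where only the bound of \<open>f\<close> by 1 is available.\<close>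
  define A where "A = 2 powr p / f x0"
  have A: "A > 0" "A \<ge> 2 powr p" "A \<ge> 1"
  proof -
    show "A > 0" "A \<ge> 2 powr p"
      using pos[of x0] le1[of x0] by (auto simp: A_def field_simps)
    moreover have "2 powr p \<ge> (1::real)"
      using p by (intro ge_one_powr_ge_zero) auto
    ultimately show "A \<ge> 1" by linarith
  qed
  have "f (x / c) \<le> A * (1 + c powr p) * f x" if x: "x \<ge> x0" and c: "c > 0" for x c
  proof -
    note fx = pos[OF x]
    have "f (x / c) \<le> A * f x \<or> f (x / c) \<le> A * c powr p * f x"
    proof -
      consider "c \<le> 1" | "c > 1" "x / c \<ge> x0" | "c > 1" "x / c < x0"
        by linarith
      then show ?thesis
      proof cases
        case 1
        have "f (x / c) \<le> f x"
          using 1 c x x0 by (intro antimonoD[OF anti]) (simp add: field_simps mult_left_le)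
        also have "\<dots> \<le> A * f x"
          using A fx by simp
        finally show ?thesis by simp
      next
        case 2
        have "f (x / c) \<le> 2 powr p * c powr p * f x"
          using growth[OF 2(2), of c] 2 by simp
        also have "\<dots> \<le> A * c powr p * f x"
          using A fx by (intro mult_right_mono) auto
        finally show ?thesis by simp
      next
        case 3
        \<comment> \<open>Here \<open>x / x0 < c\<close>, so passing from \<open>x0\<close> to
          \<open>x\<close> compares \<open>f x0\<close> with \<open>c powr p * f x\<close>. Divided
          by \<open>f x0\<close>, the claimed bound is at least 1 and hence above every value of
          \<open>f\<close>.\<close>
        have "f x0 \<le> 2 powr p * (x / x0) powr p * f x"
          using growth[of x0 "x / x0"] x x0 by simp
        also have "\<dots> \<le> 2 powr p * c powr p * f x"
          using 3 x x0 p fx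
          by (intro mult_right_mono mult_left_mono powr_mono2) (auto simp: field_simps)
        finally have "1 \<le> A * c powr p * f x"
          using pos[of x0] by (simp add: A_def field_simps)
        with le1[of "x / c"] show ?thesis by linarith
      qed
    qed
    moreover have "A * f x > 0" "A * c powr p * f x > 0"
      using A fx c by auto
    ultimately show ?thesis
      by (auto simp: algebra_simps)
  qed
  with A pos show ?thesis
    by (intro that[of A x0]) auto
qed

text \<open>Bonferroni's inequality over ordered pairs: every intersection is subtracted twice,
  which is weaker than the sharp form but enough when pair probabilities are negligible in the
  limit.\<close>

lemma (in finite_measure) measure_UN_lower_bound:
  assumes "finite I" "\<And>i. i \<in> I \<Longrightarrow> E i \<in> sets M"
  shows "(\<Sum>i\<in>I. measure M (E i)) - (\<Sum>i\<in>I. \<Sum>j\<in>I - {i}. measure M (E i \<inter> E j))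
           \<le> measure M (\<Union>i\<in>I. E i)"
  using assms
proof (induction I rule: finite_induct)
  case (insert a I)
  have E: "E a \<in> sets M" "(\<Union>i\<in>I. E i) \<in> sets M"
    using insert by auto
  have "measure M (E a \<inter> (\<Union>i\<in>I. E i)) = measure M (\<Union>i\<in>I. E a \<inter> E i)"
    by (intro arg_cong[where f = "measure M"]) auto
  also have "\<dots> \<le> (\<Sum>i\<in>I. measure M (E a \<inter> E i))"
    using insert by (intro finite_measure_subadditive_finite) auto
  finally have inter: "measure M (E a \<inter> (\<Union>i\<in>I. E i)) \<le> (\<Sum>i\<in>I. measure M (E a \<inter> E i))" .
  have "(\<Sum>i\<in>I. \<Sum>j\<in>I - {i}. measure M (E i \<inter> E j))
      \<le> (\<Sum>i\<in>I. \<Sum>j\<in>insert a I - {i}. measure M (E i \<inter> E j))"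
    using insert by (intro sum_mono sum_mono2) auto
  moreover have "insert a I - {a} = I"
    using insert by auto
  moreover have "measure M (\<Union>i\<in>insert a I. E i)
      = measure M (E a) + measure M (\<Union>i\<in>I. E i) - measure M (E a \<inter> (\<Union>i\<in>I. E i))"
    using E measure_Un3[of "E a" M "\<Union>i\<in>I. E i"] by (simp add: fmeasurable_eq_sets)
  moreover have "(\<Sum>i\<in>I. measure M (E i)) - (\<Sum>i\<in>I. \<Sum>j\<in>I - {i}. measure M (E i \<inter> E j))
      \<le> measure M (\<Union>i\<in>I. E i)"
    using insert by auto
  ultimately show ?case
    using inter insert by (simp add: sum.insert)
qed simp

text \<open>Both sides agree on measurable rectangles, which is what independence says, and
  rectangles determine a product of sigma-finite measures.\<close>

lemma distr_pair_independent_rvs: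
  assumes "prob_space M" "independent_rvs M A f B g"
  shows "distr M (A \<Otimes>\<^sub>M B) (\<lambda>\<omega>. (f \<omega>, g \<omega>)) = distr M A f \<Otimes>\<^sub>M distr M B g"
proof -
  interpret prob_space M by fact
  have [measurable]: "f \<in> M \<rightarrow>\<^sub>M A" "g \<in> M \<rightarrow>\<^sub>M B"
    and ind: "indep_set {f -` S \<inter> space M | S. S \<in> sets A} {g -` S \<inter> space M | S. S \<in> sets B}"
    using assms(2) by (auto simp: independent_rvs_def)
  interpret f: prob_space "distr M A f" by (rule prob_space_distr) measurable
  interpret g: prob_space "distr M B g" by (rule prob_space_distr) measurable
  show ?thesis
  proof (rule pair_measure_eqI[symmetric])
    fix S R assume S: "S \<in> sets (distr M A f)" and R: "R \<in> sets (distr M B g)"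
    then have SR [measurable]: "S \<in> sets A" "R \<in> sets B" by auto
    have "prob ((f -` S \<inter> space M) \<inter> (g -` R \<inter> space M)) = prob (f -` S \<inter> space M) * prob (g -` R \<inter> space M)"
      using SR by (intro indep_setD[OF ind]) auto
    moreover have "(f -` S \<inter> space M) \<inter> (g -` R \<inter> space M) = (\<lambda>\<omega>. (f \<omega>, g \<omega>)) -` (S \<times> R) \<inter> space M"
      by auto
    ultimately show "emeasure (distr M A f) S * emeasure (distr M B g) R
        = emeasure (distr M (A \<Otimes>\<^sub>M B) (\<lambda>\<omega>. (f \<omega>, g \<omega>))) (S \<times> R)"
      by (simp add: emeasure_distr emeasure_eq_measure ennreal_mult)
  qed (auto intro: f.sigma_finite_measure_axioms g.sigma_finite_measure_axioms cong: sets_pair_measure_cong)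
qed

text \<open>For each fixed value of the upper limit the sum has fixed length; the countably many
  cases are glued together.\<close>

lemma measurable_random_sum:
  fixes f :: "nat \<Rightarrow> 'a \<Rightarrow> 'b::{second_countable_topology, topological_comm_monoid_add}"
  assumes "n \<in> N \<rightarrow>\<^sub>M count_space UNIV" "\<And>i. 1 \<le> i \<Longrightarrow> f i \<in> borel_measurable N"
  shows "(\<lambda>w. \<Sum>i=1..n w. f i w) \<in> borel_measurable N"
  by (rule measurable_compose_countable[OF _ assms(1)]) (use assms(2) in auto)

section \<open>Identically distributed, pairwise asymptotically independent shocks\<close>

locale asymptotically_independent = prob_space M for M :: "'w measure" +
  fixes X :: "nat \<Rightarrow> 'w \<Rightarrow> real" and \<alpha> :: real
  assumes X_measurable: "\<And>i. i \<ge> 1 \<Longrightarrow> X i \<in> borel_measurable M"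
    and X_nonneg: "\<And>i. i \<ge> 1 \<Longrightarrow> AE \<omega> in M. 0 \<le> X i \<omega>"
    and X_ident: "\<And>i. i \<ge> 1 \<Longrightarrow> distr M borel (X i) = distr M borel (X 1)"
    and \<alpha>_pos: "0 < \<alpha>"
    and X_tail: "regularly_varying (\<lambda>x. prob {\<omega> \<in> space M. X 1 \<omega> > x}) (- \<alpha>)"
    and X_joint_tail:
      "((\<lambda>x. SUP (i, j) \<in> {(i, j). 1 \<le> i \<and> 1 \<le> j \<and> i \<noteq> j}.
           prob {\<omega> \<in> space M. X i \<omega> > x \<and> X j \<omega> > x} / prob {\<omega> \<in> space M. X 1 \<omega> > x})
         \<longlongrightarrow> 0) at_top"
begin

definition tail :: "real \<Rightarrow> real" where
  "tail x = prob {\<omega> \<in> space M. X 1 \<omega> > x}"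

lemma X_gt_sets: "i \<ge> 1 \<Longrightarrow> {\<omega> \<in> space M. X i \<omega> > x} \<in> sets M"
  using X_measurable by measurable

lemma prob_X_gt:
  assumes "i \<ge> 1"
  shows "prob {\<omega> \<in> space M. X i \<omega> > x} = tail x"
proof -
  have "prob {\<omega> \<in> space M. X k \<omega> > x} = measure (distr M borel (X k)) {x<..}" if "k \<ge> 1" for k
    using X_measurable[OF that] by (simp add: measure_distr vimage_def Int_def conj_commute)
  with assms X_ident[OF assms] show ?thesis
    unfolding tail_def by simp
qed

lemma tail_antimono: "antimono tail"
  unfolding tail_def using X_gt_sets[of 1] by (intro antimonoI finite_measure_mono) auto

lemma tail_le_1: "tail x \<le> 1"
  by (simp add: tail_def)

lemma tail_rv: "regularly_varying tail (- \<alpha>)"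
  using X_tail unfolding tail_def .

lemma eventually_tail_pos: "eventually (\<lambda>x. tail x > 0) at_top"
  using tail_rv unfolding regularly_varying_def eventually_at_top_linorder by blast

lemma tail_ratio: "c > 0 \<Longrightarrow> ((\<lambda>x. tail (c * x) / tail x) \<longlongrightarrow> c powr (- \<alpha>)) at_top"
  using tail_rv unfolding regularly_varying_def by blast

lemma tail_scaled:
  assumes "i \<ge> 1" "c \<ge> 0"
  shows "((\<lambda>x. prob {\<omega> \<in> space M. c * X i \<omega> > x} / tail x) \<longlongrightarrow> c powr \<alpha>) at_top"
proof (cases "c = 0")
  case True
  \<comment> \<open>For zero weight the event is empty once \<open>x\<close> is nonnegative, in
    agreement with \<open>0 powr \<alpha> = 0\<close>.\<close>
  have "eventually (\<lambda>x. prob {\<omega> \<in> space M. c * X i \<omega> > x} / tail x = 0) at_top"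
    using eventually_ge_at_top[of 0] by eventually_elim (simp add: True)
  then show ?thesis
    using True by (simp add: tendsto_eventually)
next
  case False
  then have c: "c > 0" using assms by simp
  have "prob {\<omega> \<in> space M. c * X i \<omega> > x} = tail (1 / c * x)" for x
    using prob_X_gt[OF assms(1), of "1 / c * x"] c by (simp add: field_simps)
  then show ?thesis
    using tail_ratio[of "1 / c"] c by (simp add: powr_minus powr_divide)
qed

text \<open>The assumed limit divides by the tail at the same argument as the joint event; the ratio
  \<open>tail (c * x) / tail x\<close>, convergent by regular variation, changes the
  normalisation.\<close>

lemma joint_tail:
  assumes "i \<ge> 1" "j \<ge> 1" "i \<noteq> j" "c > 0"
  shows "((\<lambda>x. prob {\<omega> \<in> space M. X i \<omega> > c * x \<and> X j \<omega> > c * x} / tail x) \<longlongrightarrow> 0) at_top"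
proof -
  let ?D = "{(i, j). 1 \<le> i \<and> 1 \<le> j \<and> i \<noteq> (j::nat)}"
  define g where "g = (\<lambda>x (i, j). prob {\<omega> \<in> space M. X i \<omega> > x \<and> X j \<omega> > x} / tail x)"
  define S where "S = (\<lambda>x. SUP k\<in>?D. g x k)"
  have S: "(S \<longlongrightarrow> 0) at_top"
    using X_joint_tail unfolding S_def g_def tail_def by (simp add: case_prod_unfold)
  have le: "g x (i, j) \<le> S x" for x
  proof -
    \<comment> \<open>A real supremum is an upper bound only for a family bounded above. Here 1 is a
      bound, since the joint event lies inside a single one; when \<open>tail x = 0\<close> the
      quotient is 0 by convention.\<close>
    have "g x k \<le> 1" if "k \<in> ?D" for k
    proof -
      obtain a b where k: "k = (a, b)" "1 \<le> a" "1 \<le> b"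
        using \<open>k \<in> ?D\<close> by auto
      have "prob {\<omega> \<in> space M. X a \<omega> > x \<and> X b \<omega> > x} \<le> tail x"
        unfolding prob_X_gt[OF k(2), symmetric]
        using X_gt_sets[OF k(2)] by (intro finite_measure_mono) auto
      then show ?thesis
        using k by (simp add: g_def divide_le_eq_1 tail_def) (metis measure_nonneg order_le_less)
    qed
    then have "bdd_above (g x ` ?D)"
      by (intro bdd_aboveI[of _ 1]) auto
    then show ?thesis
      unfolding S_def using assms by (intro cSUP_upper) auto
  qed
  have lim: "((\<lambda>x. S (c * x) * (tail (c * x) / tail x)) \<longlongrightarrow> 0 * c powr (- \<alpha>)) at_top"
    by (intro tendsto_mult tail_ratio assms filterlim_compose[OF S]
        filterlim_tendsto_pos_mult_at_top[OF tendsto_const] filterlim_ident)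
  have cx: "eventually (\<lambda>x. tail (c * x) > 0) at_top"
    by (intro eventually_compose_filterlim[OF eventually_tail_pos]
        filterlim_tendsto_pos_mult_at_top[OF tendsto_const] filterlim_ident assms)
  show ?thesis
  proof (rule tendsto_sandwich[OF _ _ tendsto_const])
    show "((\<lambda>x. S (c * x) * (tail (c * x) / tail x)) \<longlongrightarrow> 0) at_top"
      using lim by simp
    show "eventually (\<lambda>x. 0 \<le> prob {\<omega> \<in> space M. X i \<omega> > c * x \<and> X j \<omega> > c * x} / tail x) at_top"
      by (simp add: tail_def)
    show "eventually (\<lambda>x. prob {\<omega> \<in> space M. X i \<omega> > c * x \<and> X j \<omega> > c * x} / tail x
        \<le> S (c * x) * (tail (c * x) / tail x)) at_top"
      using cx eventually_tail_pos
    proof eventually_elim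
      case (elim x)
      then show ?case
        using le[of "c * x"] by (simp add: g_def field_simps)
    qed
  qed
qed

lemma joint_tail_weighted:
  assumes "i \<ge> 1" "j \<ge> 1" "i \<noteq> j" "b \<ge> 0" "c \<ge> 0" "\<kappa> > 0"
  shows "((\<lambda>x. prob {\<omega> \<in> space M. b * X i \<omega> > \<kappa> * x \<and> c * X j \<omega> > \<kappa> * x} / tail x) \<longlongrightarrow> 0) at_top"
proof (rule tendsto_sandwich[OF _ _ tendsto_const])
  \<comment> \<open>A common bound for both weights, so that one threshold serves both; the summand
    1 keeps it positive when both weights vanish.\<close>
  define C where "C = 1 + b + c"
  have C: "C > 0" "b \<le> C" "c \<le> C"
    using assms by (auto simp: C_def)
  show "((\<lambda>x. prob {\<omega> \<in> space M. X i \<omega> > \<kappa> / C * x \<and> X j \<omega> > \<kappa> / C * x} / tail x) \<longlongrightarrow> 0) at_top"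
    using assms C by (intro joint_tail) auto
  show "eventually (\<lambda>x. 0 \<le> prob {\<omega> \<in> space M. b * X i \<omega> > \<kappa> * x \<and> c * X j \<omega> > \<kappa> * x} / tail x) at_top"
    by (simp add: tail_def)
  \<comment> \<open>The shocks are nonnegative only almost surely, so enlarging \<open>d\<close> to
    \<open>C\<close> needs \<open>y > 0\<close>; this follows because \<open>d * y\<close> exceeds a
    nonnegative number.\<close>
  have imp: "y > \<kappa> / C * x" if "d * y > \<kappa> * x" "0 \<le> d" "d \<le> C" "x \<ge> 0" for d x y
  proof -
    have "\<kappa> * x \<ge> 0"
      using that assms by auto
    with that have "y > 0"
      by (metis linorder_not_less mult_nonneg_nonpos order_le_less_trans order_less_irrefl)
    then have "d * y \<le> C * y"
      using that by (intro mult_right_mono) auto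
    with that have "\<kappa> * x < C * y" by linarith
    then show ?thesis
      using C by (simp add: field_simps)
  qed
  have meas: "{\<omega> \<in> space M. X i \<omega> > y \<and> X j \<omega> > y} \<in> sets M" for y
    using X_measurable assms by measurable
  show "eventually (\<lambda>x. prob {\<omega> \<in> space M. b * X i \<omega> > \<kappa> * x \<and> c * X j \<omega> > \<kappa> * x} / tail x
      \<le> prob {\<omega> \<in> space M. X i \<omega> > \<kappa> / C * x \<and> X j \<omega> > \<kappa> / C * x} / tail x) at_top"
    using eventually_ge_at_top[of 0]
  proof eventually_elim
    case (elim x)
    have "prob {\<omega> \<in> space M. b * X i \<omega> > \<kappa> * x \<and> c * X j \<omega> > \<kappa> * x}
        \<le> prob {\<omega> \<in> space M. X i \<omega> > \<kappa> / C * x \<and> X j \<omega> > \<kappa> / C * x}"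
      using imp[of x b] imp[of x c] elim assms C meas by (intro finite_measure_mono) auto
    then show ?case
      by (intro divide_right_mono) (auto simp: tail_def)
  qed
qed

lemma weighted_sum_measurable [measurable]:
  "(\<lambda>\<omega>. \<Sum>i=1..n. c i * X i \<omega>) \<in> borel_measurable M"
  using X_measurable by (intro borel_measurable_sum borel_measurable_times) auto

text \<open>If no two terms exceed \<delta> x / n, then at most one does. The others together
  contribute at most \<delta> x, so that one must exceed (1 - \<delta>) x for the sum to exceed
  \<open>x\<close>.\<close>

lemma weighted_sum_tail_le:
  assumes c: "\<And>i. 1 \<le> i \<Longrightarrow> i \<le> n \<Longrightarrow> 0 \<le> c i" and \<delta>: "0 < \<delta>" "\<delta> < 1" and x: "0 \<le> x"
  shows "prob {\<omega> \<in> space M. (\<Sum>i=1..n. c i * X i \<omega>) > x}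
    \<le> (\<Sum>i=1..n. prob {\<omega> \<in> space M. c i * X i \<omega> > (1 - \<delta>) * x})
      + (\<Sum>i=1..n. \<Sum>j\<in>{1..n} - {i}.
          prob {\<omega> \<in> space M. c i * X i \<omega> > \<delta> / n * x \<and> c j * X j \<omega> > \<delta> / n * x})"
proof -
  let ?A = "\<lambda>i. {\<omega> \<in> space M. c i * X i \<omega> > (1 - \<delta>) * x}"
  let ?B = "\<lambda>i j. {\<omega> \<in> space M. c i * X i \<omega> > \<delta> / n * x \<and> c j * X j \<omega> > \<delta> / n * x}"
  have A: "?A i \<in> sets M" if "i \<in> {1..n}" for i
    using X_measurable[of i] that by auto
  have B: "?B i j \<in> sets M" if "i \<in> {1..n}" "j \<in> {1..n}" for i j
    using X_measurable[of i] X_measurable[of j] that by auto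
  have "{\<omega> \<in> space M. (\<Sum>i=1..n. c i * X i \<omega>) > x}
      \<subseteq> (\<Union>i\<in>{1..n}. ?A i) \<union> (\<Union>i\<in>{1..n}. \<Union>j\<in>{1..n} - {i}. ?B i j)"
  proof (rule subsetI, rule ccontr)
    fix \<omega>
    assume "\<omega> \<in> {\<omega> \<in> space M. (\<Sum>i=1..n. c i * X i \<omega>) > x}"
      and nU: "\<omega> \<notin> (\<Union>i\<in>{1..n}. ?A i) \<union> (\<Union>i\<in>{1..n}. \<Union>j\<in>{1..n} - {i}. ?B i j)"
    then have \<omega>: "\<omega> \<in> space M" "(\<Sum>i=1..n. c i * X i \<omega>) > x"
      by simp_all
    have n: "\<omega> \<notin> (\<Union>i\<in>{1..n}. ?A i)" "\<omega> \<notin> (\<Union>i\<in>{1..n}. \<Union>j\<in>{1..n} - {i}. ?B i j)"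
      using nU by (simp_all only: Un_iff simp_thms de_Morgan_disj)
    have nA: "c i * X i \<omega> \<le> (1 - \<delta>) * x" if "i \<in> {1..n}" for i
      using n(1) \<omega>(1) that by (auto simp: not_less)
    have nB: "c j * X j \<omega> \<le> \<delta> / n * x"
      if "i \<in> {1..n}" "c i * X i \<omega> > \<delta> / n * x" "j \<in> {1..n} - {i}" for i j
    proof (rule ccontr)
      assume "\<not> ?thesis"
      with that \<omega>(1) have "\<omega> \<in> ?B i j" by simp
      with that n(2) show False by blast
    qed
    have "(\<Sum>i=1..n. c i * X i \<omega>) \<le> x"
    proof (cases "\<exists>k\<in>{1..n}. c k * X k \<omega> > \<delta> / n * x")
      case True
      then obtain k where k: "k \<in> {1..n}" "c k * X k \<omega> > \<delta> / n * x" by auto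
      have "(\<Sum>i=1..n. c i * X i \<omega>) = c k * X k \<omega> + (\<Sum>i\<in>{1..n} - {k}. c i * X i \<omega>)"
        using k by (simp add: sum.remove)
      also have "\<dots> \<le> (1 - \<delta>) * x + (\<Sum>i\<in>{1..n} - {k}. \<delta> / n * x)"
        using nA[OF k(1)] nB[OF k] by (intro add_mono sum_mono)
      also have "(\<Sum>i\<in>{1..n} - {k}. \<delta> / n * x) \<le> (\<Sum>i\<in>{1..n}. \<delta> / n * x)"
        using \<delta> x by (intro sum_mono2) auto
      also have "\<dots> = \<delta> * x"
        using k by simp
      finally show ?thesis by (simp add: algebra_simps)
    next
      case False
      then have "(\<Sum>i=1..n. c i * X i \<omega>) \<le> (\<Sum>i\<in>{1..n}. \<delta> / n * x)"
        by (intro sum_mono) (auto simp: not_less)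
      \<comment> \<open>An inequality because \<open>n = 0\<close> is allowed, where the sum is
        empty.\<close>
      also have "\<dots> \<le> \<delta> * x"
        using \<delta> x by simp
      also have "\<dots> \<le> x"
        using \<delta> x by (simp add: mult_left_le_one_le)
      finally show ?thesis .
    qed
    with \<omega> show False by simp
  qed
  note sub = this
  have UA: "(\<Union>i\<in>{1..n}. ?A i) \<in> sets M"
    by (rule sets.finite_UN[OF finite_atLeastAtMost A])
  have UB: "(\<Union>j\<in>{1..n} - {i}. ?B i j) \<in> sets M" if "i \<in> {1..n}" for i
    by (rule sets.finite_UN[OF _ B[OF that]]) simp_all
  have UUB: "(\<Union>i\<in>{1..n}. \<Union>j\<in>{1..n} - {i}. ?B i j) \<in> sets M"
    by (rule sets.finite_UN[OF finite_atLeastAtMost UB])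
  have "prob {\<omega> \<in> space M. (\<Sum>i=1..n. c i * X i \<omega>) > x}
      \<le> prob ((\<Union>i\<in>{1..n}. ?A i) \<union> (\<Union>i\<in>{1..n}. \<Union>j\<in>{1..n} - {i}. ?B i j))"
    by (rule finite_measure_mono[OF sub sets.Un[OF UA UUB]])
  also have "\<dots> \<le> prob (\<Union>i\<in>{1..n}. ?A i) + prob (\<Union>i\<in>{1..n}. \<Union>j\<in>{1..n} - {i}. ?B i j)"
    by (rule measure_Un_le[OF UA UUB])
  also have "\<dots> \<le> (\<Sum>i=1..n. prob (?A i)) + (\<Sum>i=1..n. \<Sum>j\<in>{1..n} - {i}. prob (?B i j))"
  proof (intro add_mono)
    show "prob (\<Union>i\<in>{1..n}. ?A i) \<le> (\<Sum>i=1..n. prob (?A i))"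
      using A by (intro finite_measure_subadditive_finite) blast+
    have "prob (\<Union>i\<in>{1..n}. \<Union>j\<in>{1..n} - {i}. ?B i j)
        \<le> (\<Sum>i=1..n. prob (\<Union>j\<in>{1..n} - {i}. ?B i j))"
      using UB by (intro finite_measure_subadditive_finite) blast+
    also have "\<dots> \<le> (\<Sum>i=1..n. \<Sum>j\<in>{1..n} - {i}. prob (?B i j))"
      using B by (intro sum_mono finite_measure_subadditive_finite) blast+
    finally show "prob (\<Union>i\<in>{1..n}. \<Union>j\<in>{1..n} - {i}. ?B i j)
        \<le> (\<Sum>i=1..n. \<Sum>j\<in>{1..n} - {i}. prob (?B i j))" .
  qed
  finally show ?thesis .
qed

text \<open>Almost surely no term is negative, so one term above \<open>x\<close> already lifts the
  sum above \<open>x\<close>; Bonferroni's inequality bounds the probability of this union from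
  below.\<close>

lemma weighted_sum_tail_ge:
  assumes c: "\<And>i. 1 \<le> i \<Longrightarrow> i \<le> n \<Longrightarrow> 0 \<le> c i"
  shows "(\<Sum>i=1..n. prob {\<omega> \<in> space M. c i * X i \<omega> > x})
      - (\<Sum>i=1..n. \<Sum>j\<in>{1..n} - {i}. prob {\<omega> \<in> space M. c i * X i \<omega> > x \<and> c j * X j \<omega> > x})
    \<le> prob {\<omega> \<in> space M. (\<Sum>i=1..n. c i * X i \<omega>) > x}"
proof -
  let ?A = "\<lambda>i. {\<omega> \<in> space M. c i * X i \<omega> > x}"
  have A: "?A i \<in> sets M" if "i \<in> {1..n}" for i
    using X_measurable[of i] that by auto
  have "(\<Sum>i=1..n. prob (?A i)) - (\<Sum>i=1..n. \<Sum>j\<in>{1..n} - {i}. prob (?A i \<inter> ?A j))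
      \<le> prob (\<Union>i\<in>{1..n}. ?A i)"
    using A by (intro measure_UN_lower_bound) auto
  also have "\<dots> \<le> prob {\<omega> \<in> space M. (\<Sum>i=1..n. c i * X i \<omega>) > x}"
  proof (rule finite_measure_mono_AE)
    have "AE \<omega> in M. \<forall>i\<in>{1..n}. 0 \<le> X i \<omega>"
      using X_nonneg by (intro AE_finite_allI) auto
    then show "AE \<omega> in M. \<omega> \<in> (\<Union>i\<in>{1..n}. ?A i) \<longrightarrow>
        \<omega> \<in> {\<omega> \<in> space M. (\<Sum>i=1..n. c i * X i \<omega>) > x}"
    proof eventually_elim
      case (elim \<omega>)
      have "x < (\<Sum>i=1..n. c i * X i \<omega>)" if "k \<in> {1..n}" "x < c k * X k \<omega>" for k
      proof -
        have "c k * X k \<omega> \<le> (\<Sum>i=1..n. c i * X i \<omega>)"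
          using that elim c by (intro member_le_sum) auto
        with that show ?thesis by linarith
      qed
      then show ?case by auto
    qed
  qed measurable
  also have "(\<lambda>i j. ?A i \<inter> ?A j) = (\<lambda>i j. {\<omega> \<in> space M. c i * X i \<omega> > x \<and> c j * X j \<omega> > x})"
    by auto
  finally show ?thesis
    by (simp add: Int_def conj_commute conj_left_commute)
qed

text \<open>Single tails give the limit, and pair terms vanish relative to \<open>tail x\<close>.
  The upper bound also loses a factor 1 - \<delta> in the threshold, which continuity in \<delta>
  removes.\<close>

lemma weighted_sum_tail:
  assumes c: "\<And>i. 1 \<le> i \<Longrightarrow> i \<le> n \<Longrightarrow> 0 \<le> c i"
  shows "((\<lambda>x. prob {\<omega> \<in> space M. (\<Sum>i=1..n. c i * X i \<omega>) > x} / tail x)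
           \<longlongrightarrow> (\<Sum>i=1..n. c i powr \<alpha>)) at_top"
proof (rule order_tendstoI)
  let ?P = "\<lambda>x. prob {\<omega> \<in> space M. (\<Sum>i=1..n. c i * X i \<omega>) > x}"
  let ?L = "\<Sum>i=1..n. c i powr \<alpha>"
  \<comment> \<open>The pair remainder at level \<kappa> x: \<kappa> = 1 serves the lower bound and
    \<kappa> = \<delta> / n the upper one.\<close>
  let ?J = "\<lambda>\<kappa> x. \<Sum>i=1..n. \<Sum>j\<in>{1..n} - {i}.
    prob {\<omega> \<in> space M. c i * X i \<omega> > \<kappa> * x \<and> c j * X j \<omega> > \<kappa> * x} / tail x"
  have J: "(?J \<kappa> \<longlongrightarrow> 0) at_top" if "\<kappa> > 0" for \<kappa>
    using c that by (intro tendsto_null_sum joint_tail_weighted) auto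
  {
    fix u assume u: "u < ?L"
    have "((\<lambda>x. (\<Sum>i=1..n. prob {\<omega> \<in> space M. c i * X i \<omega> > x} / tail x) - ?J 1 x)
        \<longlongrightarrow> ?L - 0) at_top"
      using c by (intro tendsto_diff tendsto_sum tail_scaled J) auto
    then have "eventually (\<lambda>x. u < (\<Sum>i=1..n. prob {\<omega> \<in> space M. c i * X i \<omega> > x} / tail x) - ?J 1 x) at_top"
      using u by (intro order_tendstoD(1)) auto
    then show "eventually (\<lambda>x. u < ?P x / tail x) at_top"
      using eventually_tail_pos
    proof eventually_elim
      case (elim x)
      have "(\<Sum>i=1..n. prob {\<omega> \<in> space M. c i * X i \<omega> > x} / tail x) - ?J 1 x
          = ((\<Sum>i=1..n. prob {\<omega> \<in> space M. c i * X i \<omega> > x})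
            - (\<Sum>i=1..n. \<Sum>j\<in>{1..n} - {i}. prob {\<omega> \<in> space M. c i * X i \<omega> > x \<and> c j * X j \<omega> > x})) / tail x"
        by (simp only: diff_divide_distrib sum_divide_distrib mult_1)
      also have "\<dots> \<le> ?P x / tail x"
        using elim by (intro divide_right_mono weighted_sum_tail_ge c) simp_all
      finally have "(\<Sum>i=1..n. prob {\<omega> \<in> space M. c i * X i \<omega> > x} / tail x) - ?J 1 x \<le> ?P x / tail x" .
      with elim show ?case by linarith
    qed
  }
  {
    fix u assume u: "?L < u"
    \<comment> \<open>\<delta> is fixed before \<open>x\<close> grows: continuity at \<delta> = 0
      keeps the perturbed limit below \<open>u\<close>.\<close>
    have "((\<lambda>\<delta>. \<Sum>i=1..n. (c i / (1 - \<delta>)) powr \<alpha>) \<longlongrightarrow> (\<Sum>i=1..n. (c i / (1 - 0)) powr \<alpha>)) (at_right 0)"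
      using c \<alpha>_pos by (intro tendsto_intros tendsto_powr2) auto
    then have "eventually (\<lambda>\<delta>. (\<Sum>i=1..n. (c i / (1 - \<delta>)) powr \<alpha>) < u) (at_right 0)"
      using u by (intro order_tendstoD(2)) auto
    moreover have "eventually (\<lambda>\<delta>::real. \<delta> \<in> {0<..<1}) (at_right 0)"
      by (rule eventually_at_right_real) simp
    ultimately have "eventually (\<lambda>\<delta>. (\<Sum>i=1..n. (c i / (1 - \<delta>)) powr \<alpha>) < u \<and> \<delta> \<in> {0<..<1}) (at_right 0)"
      by eventually_elim auto
    then obtain \<delta> where \<delta>: "(\<Sum>i=1..n. (c i / (1 - \<delta>)) powr \<alpha>) < u" "0 < \<delta>" "\<delta> < 1"
      by (metis (no_types, lifting) eventually_happens greaterThanLessThan_iff trivial_limit_at_right_real)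
    show "eventually (\<lambda>x. ?P x / tail x < u) at_top"
    \<comment> \<open>For \<open>n = 0\<close> the level \<delta> / n would be 0, while the
      remainder estimate asks for a positive one.\<close>
    proof (cases "n = 0")
      case True
      from eventually_ge_at_top[of 0] show ?thesis
      proof eventually_elim
        case (elim x)
        with True u show ?case by simp
      qed
    next
      case False
      have "((\<lambda>x. (\<Sum>i=1..n. prob {\<omega> \<in> space M. c i / (1 - \<delta>) * X i \<omega> > x} / tail x) + ?J (\<delta> / n) x)
          \<longlongrightarrow> (\<Sum>i=1..n. (c i / (1 - \<delta>)) powr \<alpha>) + 0) at_top"
        using c \<delta> False by (intro tendsto_add tendsto_sum tail_scaled J) auto
      then have "eventually (\<lambda>x. (\<Sum>i=1..n. prob {\<omega> \<in> space M. c i / (1 - \<delta>) * X i \<omega> > x} / tail x)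
          + ?J (\<delta> / n) x < u) at_top"
        using \<delta> by (intro order_tendstoD(2)) auto
      then show ?thesis
        using eventually_tail_pos eventually_ge_at_top[of 0]
      proof eventually_elim
        case (elim x)
        have "c i / (1 - \<delta>) * y > x \<longleftrightarrow> c i * y > (1 - \<delta>) * x" for i y
          using \<delta> by (simp add: field_simps)
        then have eq: "prob {\<omega> \<in> space M. c i / (1 - \<delta>) * X i \<omega> > x}
            = prob {\<omega> \<in> space M. c i * X i \<omega> > (1 - \<delta>) * x}" for i
          by (simp only:)
        have "?P x / tail x \<le> ((\<Sum>i=1..n. prob {\<omega> \<in> space M. c i * X i \<omega> > (1 - \<delta>) * x})
            + (\<Sum>i=1..n. \<Sum>j\<in>{1..n} - {i}.
              prob {\<omega> \<in> space M. c i * X i \<omega> > \<delta> / n * x \<and> c j * X j \<omega> > \<delta> / n * x})) / tail x"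
          using elim \<delta> by (intro divide_right_mono weighted_sum_tail_le c) simp_all
        also have "\<dots> = (\<Sum>i=1..n. prob {\<omega> \<in> space M. c i / (1 - \<delta>) * X i \<omega> > x} / tail x)
            + ?J (\<delta> / n) x"
          unfolding eq by (simp only: add_divide_distrib sum_divide_distrib)
        finally have "?P x / tail x \<le> (\<Sum>i=1..n. prob {\<omega> \<in> space M. c i / (1 - \<delta>) * X i \<omega> > x} / tail x)
            + ?J (\<delta> / n) x" .
        with elim show ?case by linarith
      qed
    qed
  }
qed

text \<open>A sum of \<open>n\<close> terms above \<open>x\<close> needs some \<open>i\<close> with
  \<open>n * c i * X i \<omega> > x\<close>; the union bound and the Potter bound do the rest.
  \<open>A\<close> and \<open>x0\<close> depend on neither \<open>n\<close> nor the weights, as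
  domination requires.\<close>

lemma weighted_sum_tail_bound:
  assumes "p > \<alpha>"
  obtains A x0 where "0 < A" "\<And>x. x \<ge> x0 \<Longrightarrow> 0 < tail x"
    "\<And>x n c. x \<ge> x0 \<Longrightarrow> (\<And>i. 1 \<le> i \<Longrightarrow> i \<le> n \<Longrightarrow> 0 \<le> c i) \<Longrightarrow>
      prob {\<omega> \<in> space M. (\<Sum>i=1..n. c i * X i \<omega>) > x}
        \<le> A * (\<Sum>i=1..n. 1 + (n * c i) powr p) * tail x"
proof -
  from assms \<alpha>_pos have "0 < p" by simp
  from regularly_varying_potter_bound[OF tail_rv tail_antimono tail_le_1 assms this]
  obtain A x1 where A: "0 < A" "\<And>x. x1 \<le> x \<Longrightarrow> 0 < tail x"
    "\<And>x c. x1 \<le> x \<Longrightarrow> 0 < c \<Longrightarrow> tail (x / c) \<le> A * (1 + c powr p) * tail x"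
    by blast
  \<comment> \<open>The cutoff \<open>max 0 x1\<close> keeps \<open>x\<close> nonnegative, which
    empties the events of zero weights and settles the empty sum.\<close>
  have "prob {\<omega> \<in> space M. (\<Sum>i=1..n. c i * X i \<omega>) > x}
        \<le> A * (\<Sum>i=1..n. 1 + (n * c i) powr p) * tail x"
    if x: "x \<ge> max 0 x1" and c: "\<And>i. 1 \<le> i \<Longrightarrow> i \<le> n \<Longrightarrow> 0 \<le> c i" for x n c
  proof -
    let ?A = "\<lambda>i. {\<omega> \<in> space M. n * c i * X i \<omega> > x}"
    have m: "?A i \<in> sets M" if "i \<in> {1..n}" for i
      using X_measurable[of i] that by auto
    have "{\<omega> \<in> space M. (\<Sum>i=1..n. c i * X i \<omega>) > x} \<subseteq> (\<Union>i\<in>{1..n}. ?A i)"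
    proof (rule subsetI, rule ccontr)
      fix \<omega>
      assume "\<omega> \<in> {\<omega> \<in> space M. (\<Sum>i=1..n. c i * X i \<omega>) > x}"
      then have \<omega>: "\<omega> \<in> space M" "(\<Sum>i=1..n. c i * X i \<omega>) > x"
        by simp_all
      assume "\<omega> \<notin> (\<Union>i\<in>{1..n}. ?A i)"
      then have le: "n * c i * X i \<omega> \<le> x" if "i \<in> {1..n}" for i
        using that \<omega>(1) by (auto simp: not_less)
      have "(\<Sum>i=1..n. c i * X i \<omega>) \<le> (\<Sum>i=1..n. x / n)"
        using le by (intro sum_mono) (auto simp: field_simps)
      also have "\<dots> \<le> x"
        using x by simp
      finally show False using \<omega> by simp
    qed
    then have "prob {\<omega> \<in> space M. (\<Sum>i=1..n. c i * X i \<omega>) > x} \<le> prob (\<Union>i\<in>{1..n}. ?A i)"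
      using m by (intro finite_measure_mono sets.finite_UN) auto
    also have "\<dots> \<le> (\<Sum>i=1..n. prob (?A i))"
      using m by (intro finite_measure_subadditive_finite) auto
    also have "\<dots> \<le> (\<Sum>i=1..n. A * (1 + (n * c i) powr p) * tail x)"
    proof (rule sum_mono)
      fix i assume i: "i \<in> {1..n}"
      show "prob (?A i) \<le> A * (1 + (n * c i) powr p) * tail x"
      proof (cases "c i = 0")
        case True
        then show ?thesis
          using x A(1) A(2)[of x] by simp
      next
        case False
        with c[of i] i have ci: "n * c i > 0" by auto
        have "prob (?A i) = tail (x / (n * c i))"
          using prob_X_gt[of i "x / (n * c i)"] i ci by (simp add: field_simps)
        also have "\<dots> \<le> A * (1 + (n * c i) powr p) * tail x"
          using A(3)[of x "n * c i"] x ci by simp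
        finally show ?thesis .
      qed
    qed
    finally show ?thesis
      by (simp add: sum_distrib_left sum_distrib_right mult_ac)
  qed
  with A show ?thesis
    by (intro that[of A "max 0 x1"]) auto
qed

text \<open>Freezing \<open>W\<close> at \<open>w\<close> turns the probability, by independence,
  into the mean of the fixed-weight probabilities \<open>q x w\<close> under the law \<nu> of
  \<open>W\<close>. Divided by \<open>tail x\<close> they converge for each \<open>w\<close>, and
  the assumed integrability supplies the dominating function.\<close>

lemma random_weighted_sum_tail:
  fixes W :: "'w \<Rightarrow> 'b" and \<theta> :: "nat \<Rightarrow> 'b \<Rightarrow> real" and n :: "'b \<Rightarrow> nat"
  assumes ind: "independent_rvs M (Pi\<^sub>M {1..} (\<lambda>_. borel)) (\<lambda>\<omega>. \<lambda>i\<in>{1..}. X i \<omega>) B W"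
    and \<theta>: "\<And>i. 1 \<le> i \<Longrightarrow> \<theta> i \<in> borel_measurable B"
    and \<theta>_nonneg: "\<And>i w. 1 \<le> i \<Longrightarrow> w \<in> space B \<Longrightarrow> 0 \<le> \<theta> i w"
    and n: "n \<in> B \<rightarrow>\<^sub>M count_space UNIV"
    and p: "p > \<alpha>"
    and int: "integrable M (\<lambda>\<omega>. \<Sum>i=1..n (W \<omega>). 1 + (n (W \<omega>) * \<theta> i (W \<omega>)) powr p)"
  shows "((\<lambda>x. prob {\<omega> \<in> space M. (\<Sum>i=1..n (W \<omega>). X i \<omega> * \<theta> i (W \<omega>)) > x} / tail x)
           \<longlongrightarrow> (\<integral>\<omega>. (\<Sum>i=1..n (W \<omega>). \<theta> i (W \<omega>) powr \<alpha>) \<partial>M)) at_top"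
proof -
  let ?P = "Pi\<^sub>M {1::nat..} (\<lambda>_. borel :: real measure)"
  let ?X = "\<lambda>\<omega>. \<lambda>i\<in>{1..}. X i \<omega>"
  have X [measurable]: "?X \<in> M \<rightarrow>\<^sub>M ?P" and W [measurable]: "W \<in> M \<rightarrow>\<^sub>M B"
    using ind by (auto simp: independent_rvs_def)
  note n [measurable]
  define PX where "PX = distr M ?P ?X"
  define \<nu> where "\<nu> = distr M B W"
  interpret PX: prob_space PX unfolding PX_def by (rule prob_space_distr) measurable
  interpret \<nu>: prob_space \<nu> unfolding \<nu>_def by (rule prob_space_distr) measurable
  interpret PN: pair_prob_space PX \<nu> ..
  have [measurable_cong]: "sets PX = sets ?P" "sets \<nu> = sets B"
    by (simp_all add: PX_def \<nu>_def)
  have space_\<nu>: "space \<nu> = space B"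
    by (simp add: \<nu>_def)
  define q where "q = (\<lambda>x w. prob {\<omega> \<in> space M. (\<Sum>i=1..n w. \<theta> i w * X i \<omega>) > x})"
  define E where "E = (\<lambda>x. {(a, w) \<in> space (PX \<Otimes>\<^sub>M \<nu>). (\<Sum>i=1..n w. a i * \<theta> i w) > x})"
  have sum_meas: "(\<lambda>(a, w). \<Sum>i=1..n w. a i * \<theta> i w) \<in> borel_measurable (?P \<Otimes>\<^sub>M B)"
    unfolding case_prod_beta
  proof (rule measurable_random_sum)
    fix i :: nat assume i: "1 \<le> i"
    then have "(\<lambda>a. a i) \<in> borel_measurable ?P"
      by (intro measurable_component_singleton) auto
    with \<theta>[OF i] show "(\<lambda>z. fst z i * \<theta> i (snd z)) \<in> borel_measurable (?P \<Otimes>\<^sub>M B)"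
      by measurable
  qed measurable
  have E [measurable]: "E x \<in> sets (PX \<Otimes>\<^sub>M \<nu>)" for x
  proof -
    have "{z \<in> space (PX \<Otimes>\<^sub>M \<nu>). (case z of (a, w) \<Rightarrow> \<Sum>i=1..n w. a i * \<theta> i w) > x} \<in> sets (PX \<Otimes>\<^sub>M \<nu>)"
      using sum_meas by measurable
    then show ?thesis
      unfolding E_def by (simp add: case_prod_beta')
  qed
  \<comment> \<open>The section of \<open>E x\<close> at \<open>w\<close> pulls back to the event
    for fixed weights. The measurability of \<open>q x\<close>, not evident from its definition, is
    obtained through these sections.\<close>
  have slice: "emeasure PX ((\<lambda>a. (a, w)) -` E x) = ennreal (q x w)" if "w \<in> space \<nu>" for x w
  proof -
    have "(\<lambda>a. (a, w)) -` E x \<in> sets PX"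
      using sets_Pair2[OF E[of x], of w] .
    then have "emeasure PX ((\<lambda>a. (a, w)) -` E x) = emeasure M (?X -` ((\<lambda>a. (a, w)) -` E x) \<inter> space M)"
      unfolding PX_def sets_distr by (rule emeasure_distr[OF X])
    also have "?X -` ((\<lambda>a. (a, w)) -` E x) \<inter> space M = {\<omega> \<in> space M. (\<Sum>i=1..n w. \<theta> i w * X i \<omega>) > x}"
      using that measurable_space[OF X]
      by (auto simp: E_def space_pair_measure PX_def mult.commute)
    finally show ?thesis
      by (simp add: q_def emeasure_eq_measure)
  qed
  have q_meas: "q x \<in> borel_measurable \<nu>" for x
  proof -
    have "(\<lambda>w. emeasure PX ((\<lambda>a. (a, w)) -` E x)) \<in> borel_measurable \<nu>"
      by (rule PN.measurable_emeasure_Pair2) measurable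
    then have "(\<lambda>w. ennreal (q x w)) \<in> borel_measurable \<nu>"
      by (subst measurable_cong[where g = "\<lambda>w. emeasure PX ((\<lambda>a. (a, w)) -` E x)"]) (auto simp: slice)
    then have "(\<lambda>w. enn2real (ennreal (q x w))) \<in> borel_measurable \<nu>"
      by measurable
    then show ?thesis
      by (simp add: q_def)
  qed
  have joint: "distr M (?P \<Otimes>\<^sub>M B) (\<lambda>\<omega>. (?X \<omega>, W \<omega>)) = PX \<Otimes>\<^sub>M \<nu>"
    unfolding PX_def \<nu>_def by (rule distr_pair_independent_rvs[OF _ ind]) unfold_locales
  have XW: "(\<lambda>\<omega>. (?X \<omega>, W \<omega>)) \<in> M \<rightarrow>\<^sub>M ?P \<Otimes>\<^sub>M B"
    by measurable
  have E': "E x \<in> sets (?P \<Otimes>\<^sub>M B)" for x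
    using E[of x] sets_pair_measure_cong[of PX ?P \<nu> B] by (simp add: PX_def \<nu>_def)
  have fubini: "prob {\<omega> \<in> space M. (\<Sum>i=1..n (W \<omega>). X i \<omega> * \<theta> i (W \<omega>)) > x} = (\<integral>w. q x w \<partial>\<nu>)" for x
  proof -
    have "{\<omega> \<in> space M. (\<Sum>i=1..n (W \<omega>). X i \<omega> * \<theta> i (W \<omega>)) > x}
        = (\<lambda>\<omega>. (?X \<omega>, W \<omega>)) -` E x \<inter> space M"
      using measurable_space[OF X] measurable_space[OF W]
      by (auto simp: E_def space_pair_measure PX_def \<nu>_def)
    then have "emeasure M {\<omega> \<in> space M. (\<Sum>i=1..n (W \<omega>). X i \<omega> * \<theta> i (W \<omega>)) > x}
        = emeasure (distr M (?P \<Otimes>\<^sub>M B) (\<lambda>\<omega>. (?X \<omega>, W \<omega>))) (E x)"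
      by (simp only: emeasure_distr[OF XW E'])
    also have "\<dots> = (\<integral>\<^sup>+w. ennreal (q x w) \<partial>\<nu>)"
      unfolding joint by (subst PN.emeasure_pair_measure_alt2[OF E]) (intro nn_integral_cong slice)
    finally show ?thesis
      using q_meas by (subst integral_eq_nn_integral) (auto simp: measure_def q_def)
  qed
  from weighted_sum_tail_bound[OF p] obtain A x0 where A: "0 < A" "\<And>x. x \<ge> x0 \<Longrightarrow> 0 < tail x"
    "\<And>x n c. x \<ge> x0 \<Longrightarrow> (\<And>i. 1 \<le> i \<Longrightarrow> i \<le> n \<Longrightarrow> 0 \<le> c i) \<Longrightarrow>
      prob {\<omega> \<in> space M. (\<Sum>i=1..n. c i * X i \<omega>) > x}
        \<le> A * (\<Sum>i=1..n. 1 + (n * c i) powr p) * tail x"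
    by blast
  have meas_powr: "(\<lambda>w. \<Sum>i=1..n w. \<theta> i w powr \<alpha>) \<in> borel_measurable B"
  proof (intro measurable_random_sum n)
    fix i :: nat assume "1 \<le> i"
    note [measurable] = \<theta>[OF this]
    show "(\<lambda>w. \<theta> i w powr \<alpha>) \<in> borel_measurable B" by measurable
  qed
  have meas_dom: "(\<lambda>w. \<Sum>i=1..n w. 1 + (n w * \<theta> i w) powr p) \<in> borel_measurable B"
  proof (intro measurable_random_sum n)
    fix i :: nat assume "1 \<le> i"
    note [measurable] = \<theta>[OF this]
    show "(\<lambda>w. 1 + (n w * \<theta> i w) powr p) \<in> borel_measurable B" by measurable
  qed
  have "((\<lambda>x. \<integral>w. q x w / tail x \<partial>\<nu>) \<longlongrightarrow> (\<integral>w. (\<Sum>i=1..n w. \<theta> i w powr \<alpha>) \<partial>\<nu>)) at_top"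
  proof (rule integral_dominated_convergence_at_top[where w = "\<lambda>w. A * (\<Sum>i=1..n w. 1 + (n w * \<theta> i w) powr p)"])
    show "(\<lambda>w. \<Sum>i=1..n w. \<theta> i w powr \<alpha>) \<in> borel_measurable \<nu>"
      using meas_powr by measurable
    show "(\<lambda>w. q x w / tail x) \<in> borel_measurable \<nu>" for x
      using q_meas by measurable
    show "integrable \<nu> (\<lambda>w. A * (\<Sum>i=1..n w. 1 + (n w * \<theta> i w) powr p))"
      using int unfolding \<nu>_def
      by (intro integrable_mult_right) (subst integrable_distr_eq[OF W meas_dom])
    show "AE w in \<nu>. ((\<lambda>x. q x w / tail x) \<longlongrightarrow> (\<Sum>i=1..n w. \<theta> i w powr \<alpha>)) at_top"
      unfolding q_def by (intro AE_I2 weighted_sum_tail) (auto simp: space_\<nu> \<theta>_nonneg)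
    show "eventually (\<lambda>x. AE w in \<nu>. norm (q x w / tail x) \<le> A * (\<Sum>i=1..n w. 1 + (n w * \<theta> i w) powr p)) at_top"
      using eventually_ge_at_top[of x0]
    proof eventually_elim
      case (elim x)
      have "norm (q x w / tail x) \<le> A * (\<Sum>i=1..n w. 1 + (n w * \<theta> i w) powr p)" if "w \<in> space \<nu>" for w
        using A(3)[OF elim, of "n w" "\<lambda>i. \<theta> i w"] A(2)[OF elim] that
        by (simp add: q_def \<theta>_nonneg space_\<nu> divide_le_eq)
      then show ?case by (rule AE_I2)
    qed
  qed
  then show ?thesis
    unfolding fubini \<nu>_def using meas_powr by (simp add: integral_distr[OF W])
qed

end

section \<open>Campbell formula for the Poisson points\<close>

lemma independent_rvs_compose_left:
  assumes "prob_space M" "independent_rvs M A f B g" "u \<in> A \<rightarrow>\<^sub>M C"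
  shows "independent_rvs M C (\<lambda>\<omega>. u (f \<omega>)) B g"
proof -
  interpret prob_space M by fact
  have [measurable]: "f \<in> M \<rightarrow>\<^sub>M A" "g \<in> M \<rightarrow>\<^sub>M B"
    and ind: "indep_set {f -` S \<inter> space M | S. S \<in> sets A} {g -` S \<inter> space M | S. S \<in> sets B}"
    using assms(2) by (auto simp: independent_rvs_def)
  note assms(3) [measurable]
  have "\<exists>R. (\<lambda>\<omega>. u (f \<omega>)) -` S \<inter> space M = f -` R \<inter> space M \<and> R \<in> sets A" if "S \<in> sets C" for S
  proof (intro exI conjI)
    show "u -` S \<inter> space A \<in> sets A"
      using that by measurable
    show "(\<lambda>\<omega>. u (f \<omega>)) -` S \<inter> space M = f -` (u -` S \<inter> space A) \<inter> space M"
      using measurable_space[of f M A] by auto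
  qed
  then have sub: "{(\<lambda>\<omega>. u (f \<omega>)) -` S \<inter> space M | S. S \<in> sets C} \<subseteq> {f -` S \<inter> space M | S. S \<in> sets A}"
    by auto
  have "indep_set {(\<lambda>\<omega>. u (f \<omega>)) -` S \<inter> space M | S. S \<in> sets C} {g -` S \<inter> space M | S. S \<in> sets B}"
    unfolding indep_set_def
  proof (rule indep_sets_mono_sets[OF ind[unfolded indep_set_def]])
    fix i :: bool
    show "case_bool {(\<lambda>\<omega>. u (f \<omega>)) -` S \<inter> space M | S. S \<in> sets C} {g -` S \<inter> space M | S. S \<in> sets B} i
        \<subseteq> case_bool {f -` S \<inter> space M | S. S \<in> sets A} {g -` S \<inter> space M | S. S \<in> sets B} i"
      using sub by (cases i) (simp_all only: bool.case subset_refl)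
  qed
  then show ?thesis
    by (simp add: independent_rvs_def)
qed

text \<open>\<open>\<mu>\<close> stands for the law of a random function of time. The values are
  extended reals because the moment may be infinite at single times; only its integral against the
  intensity is controlled.\<close>

definition power_moment :: "(real \<Rightarrow> real) measure \<Rightarrow> real \<Rightarrow> real \<Rightarrow> ennreal" where
  "power_moment \<mu> q s = (\<integral>\<^sup>+k. ennreal (k s powr q) \<partial>\<mu>)"

lemma nonneg_function_space_powr_measurable:
  assumes "nonneg_function_space borel G"
  shows "(\<lambda>(k, s). ennreal (k s powr q)) \<in> borel_measurable (G \<Otimes>\<^sub>M borel)"
proof -
  have "(\<lambda>(k, s). k s) \<in> borel_measurable (G \<Otimes>\<^sub>M borel)"
    using assms by (simp add: nonneg_function_space_def)
  moreover have "(\<lambda>r::real. ennreal (r powr q)) \<in> borel_measurable borel"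
    by measurable
  ultimately show ?thesis
    by (auto dest: measurable_compose simp: case_prod_beta)
qed

lemma power_moment_measurable:
  assumes "nonneg_function_space borel G" "sets \<mu> = sets G" "sigma_finite_measure \<mu>"
  shows "power_moment \<mu> q \<in> borel_measurable borel"
proof -
  interpret sigma_finite_measure \<mu> by fact
  have "(\<lambda>(s, k). ennreal (k s powr q)) \<in> borel_measurable (borel \<Otimes>\<^sub>M G)"
    using measurable_compose[OF measurable_pair_swap' nonneg_function_space_powr_measurable[OF assms(1), of q]]
    by (simp add: case_prod_beta)
  also have "borel_measurable (borel \<Otimes>\<^sub>M G) = borel_measurable (borel \<Otimes>\<^sub>M \<mu>)"
    using assms(2) by (intro measurable_cong_sets sets_pair_measure_cong) simp_all
  finally show ?thesis
    unfolding power_moment_def by (rule borel_measurable_nn_integral)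
qed

text \<open>Joint measurability of evaluation lets Fubini integrate out \<open>f\<close> with
  \<open>Z\<close> frozen. The factor \<open>u (Z \<omega>)\<close> carries whatever else depends on
  the times, so this covers both a single time such as \<open>V0\<close> and one point taken out of
  the whole sequence.\<close>

lemma nn_integral_evaluate_independent:
  assumes M: "prob_space M" and ind: "independent_rvs M G f B Z" and G: "nonneg_function_space borel G"
    and s [measurable]: "s \<in> borel_measurable B" and u [measurable]: "u \<in> borel_measurable B"
  shows "(\<integral>\<^sup>+\<omega>. u (Z \<omega>) * ennreal (f \<omega> (s (Z \<omega>)) powr q) \<partial>M)
    = (\<integral>\<^sup>+\<omega>. u (Z \<omega>) * power_moment (distr M G f) q (s (Z \<omega>)) \<partial>M)"
proof -
  interpret prob_space M by fact
  have [measurable]: "f \<in> M \<rightarrow>\<^sub>M G" "Z \<in> M \<rightarrow>\<^sub>M B"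
    using ind by (auto simp: independent_rvs_def)
  interpret f: prob_space "distr M G f" by (rule prob_space_distr) measurable
  interpret Z: prob_space "distr M B Z" by (rule prob_space_distr) measurable
  interpret fZ: pair_sigma_finite "distr M G f" "distr M B Z" ..
  define \<psi> where "\<psi> = (\<lambda>(k, z). u z * ennreal (k (s z) powr q))"
  have eval: "(\<lambda>x. ennreal (fst x (s (snd x)) powr q)) \<in> borel_measurable (G \<Otimes>\<^sub>M B)"
  proof -
    have "(\<lambda>x. (fst x, s (snd x))) \<in> G \<Otimes>\<^sub>M B \<rightarrow>\<^sub>M G \<Otimes>\<^sub>M borel"
      by measurable
    from measurable_compose[OF this nonneg_function_space_powr_measurable[OF G, of q]] show ?thesis
      by simp
  qed
  then have \<psi>: "\<psi> \<in> borel_measurable (G \<Otimes>\<^sub>M B)"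
    unfolding \<psi>_def case_prod_beta by measurable
  have \<psi>': "\<psi> \<in> borel_measurable (distr M G f \<Otimes>\<^sub>M distr M B Z)"
    using \<psi> by (simp cong: measurable_cong_sets sets_pair_measure_cong)
  have "power_moment (distr M G f) q \<in> borel_measurable borel"
    by (rule power_moment_measurable[OF G]) (simp_all add: f.sigma_finite_measure_axioms)
  note [measurable] = this
  have "(\<integral>\<^sup>+\<omega>. u (Z \<omega>) * ennreal (f \<omega> (s (Z \<omega>)) powr q) \<partial>M) = (\<integral>\<^sup>+\<omega>. \<psi> (f \<omega>, Z \<omega>) \<partial>M)"
    by (simp add: \<psi>_def)
  also have "\<dots> = (\<integral>\<^sup>+x. \<psi> x \<partial>distr M (G \<Otimes>\<^sub>M B) (\<lambda>\<omega>. (f \<omega>, Z \<omega>)))"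
    using \<psi> by (subst nn_integral_distr) simp_all
  also have "\<dots> = (\<integral>\<^sup>+z. (\<integral>\<^sup>+k. \<psi> (k, z) \<partial>distr M G f) \<partial>distr M B Z)"
    unfolding distr_pair_independent_rvs[OF M ind] by (rule fZ.nn_integral_snd[OF \<psi>', symmetric])
  also have "\<dots> = (\<integral>\<^sup>+z. u z * power_moment (distr M G f) q (s z) \<partial>distr M B Z)"
  proof (rule nn_integral_cong)
    fix z assume "z \<in> space (distr M B Z)"
    have "(\<lambda>k. ennreal (k (s z) powr q)) \<in> borel_measurable G"
      using measurable_compose[OF measurable_Pair2' nonneg_function_space_powr_measurable[OF G, of q], of "s z"]
      by simp
    then show "(\<integral>\<^sup>+k. \<psi> (k, z) \<partial>distr M G f) = u z * power_moment (distr M G f) q (s z)"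
      unfolding \<psi>_def power_moment_def by (simp add: nn_integral_cmult)
  qed
  also have "\<dots> = (\<integral>\<^sup>+\<omega>. u (Z \<omega>) * power_moment (distr M G f) q (s (Z \<omega>)) \<partial>M)"
    by (subst nn_integral_distr) simp_all
  finally show ?thesis .
qed

section \<open>Identities for Poisson weights and index sets\<close>

lemma power_le_fact_exp:
  fixes x :: real
  assumes "0 \<le> x"
  shows "x ^ k \<le> fact k * exp x"
proof -
  have "summable (\<lambda>n. x ^ n /\<^sub>R fact n)"
    by (rule summable_exp_generic)
  then have "(\<Sum>n\<in>{k}. x ^ n /\<^sub>R fact n) \<le> (\<Sum>n. x ^ n /\<^sub>R fact n)"
    using assms by (intro sum_le_suminf) auto
  then have "x ^ k / fact k \<le> exp x"
    by (simp only: exp_def sum.insert[OF finite.emptyI] empty_iff not_False_eq_True sum.empty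
        add_0_right real_scaleR_def divide_inverse mult.commute)
  then show ?thesis
    by (simp only: pos_divide_le_eq[OF fact_gt_zero] mult.commute)
qed

text \<open>For independent Poisson counts with means \<open>a\<close> and \<open>b\<close> this is
  the mean of the second on the event that the total is \<open>n\<close>: given the total, it is
  binomial with success probability b / (a + b). The computation is k / k! = 1 / (k - 1)! followed
  by the binomial theorem for n - 1.\<close>

lemma poisson_thinned_mean:
  fixes a b :: real
  assumes "a + b \<noteq> 0"
  shows "(\<Sum>k\<le>n. real k * ((a ^ (n - k) / fact (n - k) * exp (- a)) * (b ^ k / fact k * exp (- b))))
    = (a + b) ^ n / fact n * exp (- (a + b)) * n / (a + b) * b"
proof (cases n)
  case (Suc n')
  define f where "f = (\<lambda>k. real k * ((a ^ (n - k) / fact (n - k) * exp (- a)) * (b ^ k / fact k * exp (- b))))"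
  define c where "c = b * exp (- (a + b)) / fact n'"
  have f_Suc: "f (Suc k) = c * (of_nat (n' choose k) * b ^ k * a ^ (n' - k))" if "k \<le> n'" for k
  proof -
    have "exp (- (a + b)) = exp (- a) * exp (- b)"
      by (simp add: exp_add[symmetric])
    then show ?thesis
      using that Suc by (simp add: f_def c_def binomial_fact field_simps del: of_nat_Suc)
  qed
  have f_0: "f 0 = 0"
    by (simp add: f_def)
  have "sum f {..n} = f 0 + (\<Sum>k\<le>n'. f (Suc k))"
    by (simp only: Suc sum.atMost_Suc_shift)
  also have "\<dots> = (\<Sum>k\<le>n'. c * (of_nat (n' choose k) * b ^ k * a ^ (n' - k)))"
    using f_Suc by (simp add: f_0)
  also have "\<dots> = c * (b + a) ^ n'"
    by (simp only: binomial_ring sum_distrib_left)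
  also have "\<dots> = (a + b) ^ n / fact n * exp (- (a + b)) * n / (a + b) * b"
    using assms Suc by (simp add: c_def add.commute del: of_nat_Suc)
  finally show ?thesis
    by (simp only: f_def)
qed simp

text \<open>Meant for the indices of the points up to the horizon, which are closed downwards
  because the points are ordered.\<close>

lemma downward_closed_eq_atLeastAtMost_card:
  fixes S :: "nat set"
  assumes "finite S" and pos: "\<And>i. i \<in> S \<Longrightarrow> 1 \<le> i"
    and down: "\<And>i. 1 \<le> i \<Longrightarrow> Suc i \<in> S \<Longrightarrow> i \<in> S"
  shows "S = {1..card S}"
proof (cases "S = {}")
  case False
  have up: "k \<in> S" if "1 \<le> k" "k \<le> Max S" for k
    using that(2,1)
  proof (induction k rule: inc_induct)
    case base
    then show ?case using assms(1) False by simp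
  next
    case (step k)
    then show ?case using down[of k] by simp
  qed
  have S: "S = {1..Max S}"
  proof
    show "S \<subseteq> {1..Max S}"
      by (meson atLeastAtMost_iff subsetI pos Max_ge[OF assms(1)])
    show "{1..Max S} \<subseteq> S"
      by (meson atLeastAtMost_iff subsetI up)
  qed
  then have "card S = Max S"
    by (metis card_atLeastAtMost diff_Suc_1)
  with S show ?thesis
    by simp
qed simp

section \<open>Counts of the Poisson process up to the horizon\<close>

locale poisson_points = prob_space M for M :: "'w measure" +
  fixes lam :: "real \<Rightarrow> real" and pts :: "nat \<Rightarrow> 'w \<Rightarrow> ennreal" and T :: real
  assumes points: "poisson_process M lam pts"
    and T_pos: "0 < T"
    and m_pos: "0 < cumulative_intensity lam T" and m_finite: "cumulative_intensity lam T < \<infinity>"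
begin

abbreviation \<Lambda> :: "real \<Rightarrow> ennreal" where
  "\<Lambda> \<equiv> cumulative_intensity lam"

abbreviation N :: "real \<Rightarrow> 'w \<Rightarrow> nat" where
  "N \<equiv> point_count pts"

definition m :: real where
  "m = enn2real (\<Lambda> T)"

definition poisson_weight :: "nat \<Rightarrow> real" where
  "poisson_weight n = m ^ n / fact n * exp (- m)"

lemma m_gt_0: "0 < m"
  using m_pos m_finite by (simp add: m_def enn2real_positive_iff)

lemma \<Lambda>_T: "\<Lambda> T = ennreal m"
  using m_finite by (simp add: m_def)

text \<open>The intensity is known to be measurable only on the nonnegative half-line, so it is
  first cut to \<open>{0..}\<close>; the indicator of \<open>{0..t}\<close> hides the
  difference.\<close>

lemma lam_measurable: "(\<lambda>s. ennreal (lam s) * indicator {0..t} s) \<in> borel_measurable borel"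
proof -
  have [measurable]: "(\<lambda>s. indicator {0..} s * lam s) \<in> borel_measurable borel"
    using points by (simp add: poisson_process_def set_borel_measurable_def)
  have "(\<lambda>s. ennreal (indicator {0..} s * lam s) * indicator {0..t} s) \<in> borel_measurable borel"
    by measurable
  also have "(\<lambda>s. ennreal (indicator {0..} s * lam s) * indicator {0..t} s) = (\<lambda>s. ennreal (lam s) * indicator {0..t} s)"
    by (auto simp: fun_eq_iff indicator_def)
  finally show ?thesis .
qed

lemma \<Lambda>_mono: "s \<le> t \<Longrightarrow> \<Lambda> s \<le> \<Lambda> t"
  unfolding cumulative_intensity_def by (intro nn_integral_mono mult_left_mono) (auto simp: indicator_def)

lemma \<Lambda>_finite: "t \<le> T \<Longrightarrow> \<Lambda> t < \<infinity>"
  using \<Lambda>_mono m_finite by (metis order_le_less_trans)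

lemma \<Lambda>_0: "\<Lambda> 0 = 0"
proof -
  have ae: "AE s in lborel. s \<noteq> (0::real)"
    by (rule AE_lborel_singleton)
  have "\<Lambda> 0 = (\<integral>\<^sup>+s. 0 \<partial>(lborel :: real measure))"
    unfolding cumulative_intensity_def
    by (rule nn_integral_cong_AE) (use ae in \<open>auto elim!: eventually_mono simp: indicator_def\<close>)
  then show ?thesis by simp
qed

lemma intensity_Ioi:
  assumes "0 \<le> t" "t \<le> T"
  shows "(\<integral>\<^sup>+s. ennreal (lam s) * indicator {0..T} s * indicator {t<..} s \<partial>lborel) = \<Lambda> T - \<Lambda> t"
proof -
  note [measurable] = lam_measurable
  have "\<Lambda> T = (\<integral>\<^sup>+s. ennreal (lam s) * indicator {0..t} s
      + ennreal (lam s) * indicator {0..T} s * indicator {t<..} s \<partial>lborel)"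
    unfolding cumulative_intensity_def using assms by (intro nn_integral_cong) (auto simp: indicator_def)
  also have "\<dots> = \<Lambda> t + (\<integral>\<^sup>+s. ennreal (lam s) * indicator {0..T} s * indicator {t<..} s \<partial>lborel)"
    unfolding cumulative_intensity_def by (intro nn_integral_add) measurable
  finally show ?thesis
    using \<Lambda>_finite[of t] assms by (simp add: ennreal_add_diff_cancel)
qed

lemma pts_measurable: "1 \<le> i \<Longrightarrow> pts i \<in> borel_measurable M"
  using points by (simp add: poisson_process_def)

lemma N_measurable [measurable]: "N t \<in> M \<rightarrow>\<^sub>M count_space UNIV"
proof -
  have "{\<omega> \<in> space M. i \<in> {i. 1 \<le> i \<and> pts i \<omega> \<le> ennreal t}} \<in> sets M" for i
  proof (cases "1 \<le> i")
    case True
    note [measurable] = pts_measurable[OF this]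
    show ?thesis using True by simp
  qed simp
  then show ?thesis
    unfolding point_count_def by (rule measurable_card)
qed

lemma AE_finite_points:
  "t \<le> T \<Longrightarrow> AE \<omega> in M. finite {i. 1 \<le> i \<and> pts i \<omega> \<le> ennreal t}"
proof -
  assume "t \<le> T"
  have "AE \<omega> in M. finite {i. 1 \<le> i \<and> pts i \<omega> \<le> ennreal T}"
    using points T_pos m_finite by (simp add: poisson_process_def)
  then show ?thesis
  proof eventually_elim
    case (elim \<omega>)
    then show ?case
      by (rule rev_finite_subset) (use \<open>t \<le> T\<close> in \<open>auto intro: order_trans ennreal_leI\<close>)
  qed
qed

lemma AE_N_0: "AE \<omega> in M. N 0 \<omega> = 0"
  using points by (simp add: poisson_process_def)

text \<open>\<open>card\<close> of an infinite set is 0, so monotonicity of the counts is an almost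
  sure statement resting on finiteness of the points up to \<open>T\<close>.\<close>

lemma AE_N_mono: "t \<le> T \<Longrightarrow> AE \<omega> in M. N t \<omega> \<le> N T \<omega>"
  using AE_finite_points[OF order_refl]
proof eventually_elim
  case (elim \<omega>)
  then show ?case
    unfolding point_count_def by (intro card_mono) (auto intro: order_trans ennreal_leI)
qed

lemma prob_increment:
  assumes "0 \<le> s" "s \<le> t" "t \<le> T"
  shows "prob {\<omega> \<in> space M. N t \<omega> - N s \<omega> = k}
    = enn2real (\<Lambda> t - \<Lambda> s) ^ k / fact k * exp (- enn2real (\<Lambda> t - \<Lambda> s))"
proof -
  have "\<Lambda> t < \<infinity>" using assms by (intro \<Lambda>_finite)
  with points assms show ?thesis
    unfolding poisson_process_def Let_def by blast
qed

lemma prob_N: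
  assumes "0 \<le> t" "t \<le> T"
  shows "prob {\<omega> \<in> space M. N t \<omega> = k} = enn2real (\<Lambda> t) ^ k / fact k * exp (- enn2real (\<Lambda> t))"
proof -
  have "prob {\<omega> \<in> space M. N t \<omega> = k} = prob {\<omega> \<in> space M. N t \<omega> - N 0 \<omega> = k}"
    using AE_N_0 by (intro finite_measure_eq_AE) (auto elim!: eventually_mono)
  then show ?thesis
    using prob_increment[of 0 t k] assms by (simp add: \<Lambda>_0)
qed

lemma prob_N_increment:
  assumes "0 \<le> t" "t \<le> T"
  shows "prob {\<omega> \<in> space M. N t \<omega> = j \<and> N T \<omega> - N t \<omega> = k}
    = prob {\<omega> \<in> space M. N t \<omega> = j} * prob {\<omega> \<in> space M. N T \<omega> - N t \<omega> = k}"
proof -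
  \<comment> \<open>The grid 0, t, T, whose two increments are N(t) - N(0) and N(T) - N(t); the
    first equals N(t) almost surely.\<close>
  define \<tau> where "\<tau> = (\<lambda>k::nat. if k = 0 then 0 else if k = 1 then t else T)"
  define D where "D = (\<lambda>k \<omega>. N (\<tau> (Suc k)) \<omega> - N (\<tau> k) \<omega>)"
  define A where "A = (\<lambda>i::nat. if i = 0 then {j} else {k})"
  have "0 \<le> \<tau> 0 \<and> (\<forall>k<2. \<tau> k \<le> \<tau> (Suc k)) \<and> \<Lambda> (\<tau> 2) < \<infinity>"
    using assms m_finite by (auto simp: \<tau>_def)
  then have "indep_vars (\<lambda>_. count_space UNIV) D {..<2}"
    using points unfolding poisson_process_def D_def by blast
  then have "prob (\<Inter>i\<in>{..<2}. D i -` A i \<inter> space M) = (\<Prod>i\<in>{..<2}. prob (D i -` A i \<inter> space M))"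
    by (rule indep_varsD) (auto simp: lessThan_empty_iff)
  moreover have "{..<2::nat} = {0, 1}" by auto
  moreover have "D 0 -` A 0 \<inter> space M = {\<omega> \<in> space M. N t \<omega> - N 0 \<omega> = j}"
    "D 1 -` A 1 \<inter> space M = {\<omega> \<in> space M. N T \<omega> - N t \<omega> = k}"
    by (auto simp: D_def A_def \<tau>_def)
  ultimately have "prob ({\<omega> \<in> space M. N t \<omega> - N 0 \<omega> = j} \<inter> {\<omega> \<in> space M. N T \<omega> - N t \<omega> = k})
    = prob {\<omega> \<in> space M. N t \<omega> - N 0 \<omega> = j} * prob {\<omega> \<in> space M. N T \<omega> - N t \<omega> = k}"
    by simp
  moreover have "prob ({\<omega> \<in> space M. N t \<omega> - N 0 \<omega> = j} \<inter> {\<omega> \<in> space M. N T \<omega> - N t \<omega> = k})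
    = prob {\<omega> \<in> space M. N t \<omega> = j \<and> N T \<omega> - N t \<omega> = k}"
    using AE_N_0 by (intro finite_measure_eq_AE) (auto elim!: eventually_mono)
  moreover have "prob {\<omega> \<in> space M. N t \<omega> - N 0 \<omega> = j} = prob {\<omega> \<in> space M. N t \<omega> = j}"
    using AE_N_0 by (intro finite_measure_eq_AE) (auto elim!: eventually_mono)
  ultimately show ?thesis by simp
qed

text \<open>The event of total \<open>n\<close> is split by the value \<open>k\<close> of the
  increment. Count and increment are independent Poisson variables with means \<Lambda>(t) and
  \<Lambda>(T) - \<Lambda>(t), so \<open>poisson_thinned_mean\<close> evaluates the sum.\<close>

lemma nn_integral_increment_given_total:
  assumes t: "0 \<le> t" "t \<le> T"
  shows "(\<integral>\<^sup>+\<omega>. indicator {n} (N T \<omega>) * of_nat (N T \<omega> - N t \<omega>) \<partial>M)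
    = ennreal (poisson_weight n * n / m) * (\<Lambda> T - \<Lambda> t)"
proof -
  define a b where "a = enn2real (\<Lambda> t)" and "b = enn2real (\<Lambda> T - \<Lambda> t)"
  have fin: "\<Lambda> t < \<infinity>" "\<Lambda> T - \<Lambda> t < \<infinity>" "\<Lambda> t + (\<Lambda> T - \<Lambda> t) = \<Lambda> T"
    using \<Lambda>_finite[OF t(2)] m_finite \<Lambda>_mono[OF t(2)]
    by (auto simp: diff_add_self_ennreal add.commute less_top[symmetric] intro: ennreal_minus_eq_top[THEN iffD1])
  have "m = enn2real (\<Lambda> t + (\<Lambda> T - \<Lambda> t))"
    by (simp only: fin(3) m_def)
  then have ab: "a + b = m"
    using fin(1,2) by (simp add: enn2real_plus a_def b_def)
  have b: "\<Lambda> T - \<Lambda> t = ennreal b" "0 \<le> b"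
    using fin by (simp_all add: b_def)
  let ?S = "\<lambda>k. {\<omega> \<in> space M. N t \<omega> = n - k \<and> N T \<omega> - N t \<omega> = k}"
  have "(\<integral>\<^sup>+\<omega>. indicator {n} (N T \<omega>) * of_nat (N T \<omega> - N t \<omega>) \<partial>M)
      = (\<integral>\<^sup>+\<omega>. (\<Sum>k\<le>n. of_nat k * indicator (?S k) \<omega>) \<partial>M)"
  proof (rule nn_integral_cong_AE)
    show "AE \<omega> in M. indicator {n} (N T \<omega>) * of_nat (N T \<omega> - N t \<omega>)
        = (\<Sum>k\<le>n. of_nat k * indicator (?S k) \<omega> :: ennreal)"
      \<comment> \<open>Subtraction of counts is truncated: an increment \<open>k\<close> together
        with \<open>N t \<omega> = n - k\<close> is sure to give total \<open>n\<close> only where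
        \<open>N t \<omega> \<le> N T \<omega>\<close>.\<close>
      using AE_N_mono[OF t(2)] AE_space
    proof eventually_elim
      case (elim \<omega>)
      have "of_nat k * indicator (?S k) \<omega>
          = (if N T \<omega> - N t \<omega> = k then indicator {n} (N T \<omega>) * of_nat k else 0 :: ennreal)" if "k \<le> n" for k
        using elim that by (auto simp: indicator_def)
      then have "(\<Sum>k\<le>n. of_nat k * indicator (?S k) \<omega> :: ennreal)
          = (\<Sum>k\<le>n. if N T \<omega> - N t \<omega> = k then indicator {n} (N T \<omega>) * of_nat k else 0)"
        by (intro sum.cong) auto
      also have "\<dots> = indicator {n} (N T \<omega>) * of_nat (N T \<omega> - N t \<omega>)"
        by (auto simp: sum.delta indicator_def)
      finally show ?case by simp
    qed
  qed
  also have "\<dots> = (\<Sum>k\<le>n. of_nat k * emeasure M (?S k))"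
    by (subst nn_integral_sum) (auto simp: nn_integral_cmult)
  also have "\<dots> = (\<Sum>k\<le>n. ennreal (real k * ((a ^ (n - k) / fact (n - k) * exp (- a)) * (b ^ k / fact k * exp (- b)))))"
  proof (intro sum.cong refl)
    fix k
    have "prob (?S k) = a ^ (n - k) / fact (n - k) * exp (- a) * (b ^ k / fact k * exp (- b))"
      unfolding prob_N_increment[OF t] prob_N[OF t] prob_increment[OF t order_refl] a_def b_def ..
    then show "of_nat k * emeasure M (?S k)
        = ennreal (real k * ((a ^ (n - k) / fact (n - k) * exp (- a)) * (b ^ k / fact k * exp (- b))))"
      unfolding emeasure_eq_measure ennreal_of_nat_eq_real_of_nat
      by (simp only: ennreal_mult'[OF of_nat_0_le_iff])
  qed
  also have "\<dots> = ennreal (\<Sum>k\<le>n. real k * ((a ^ (n - k) / fact (n - k) * exp (- a)) * (b ^ k / fact k * exp (- b))))"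
    by (rule sum_ennreal) (simp add: a_def b_def)
  also have "\<dots> = ennreal (poisson_weight n * n / m * b)"
    using m_gt_0 by (subst poisson_thinned_mean) (simp_all add: ab poisson_weight_def)
  also have "\<dots> = ennreal (poisson_weight n * n / m) * (\<Lambda> T - \<Lambda> t)"
    unfolding b(1) by (rule ennreal_mult''[OF b(2)])
  finally show ?thesis .
qed

lemma AE_points_eq: "AE \<omega> in M. {i. 1 \<le> i \<and> pts i \<omega> \<le> ennreal T} = {1..N T \<omega>}"
proof -
  have "AE \<omega> in M. \<forall>i\<ge>1. pts i \<omega> \<le> pts (Suc i) \<omega>"
    using points by (simp add: poisson_process_def)
  with AE_finite_points[OF order_refl] show ?thesis
  proof eventually_elim
    case (elim \<omega>)
    then show ?case
      unfolding point_count_def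
      by (intro downward_closed_eq_atLeastAtMost_card) (auto intro: order_trans)
  qed
qed

section \<open>Campbell formula with a weight depending on the total count\<close>

lemma function_of_N_measurable:
  fixes g :: "nat \<Rightarrow> 'b :: topological_space"
  shows "(\<lambda>\<omega>. g (N t \<omega>)) \<in> borel_measurable M"
  by (rule measurable_compose[OF N_measurable]) simp

lemma points_pair_measurable:
  fixes f :: "nat \<Rightarrow> 'w \<Rightarrow> 'b"
  assumes "\<And>i. 1 \<le> i \<Longrightarrow> f i \<in> M \<rightarrow>\<^sub>M K"
  shows "(\<lambda>(i, \<omega>). f i \<omega>) \<in> count_space {1..} \<Otimes>\<^sub>M M \<rightarrow>\<^sub>M K"
  using assms by (intro measurable_pair_measure_countable1) auto

interpretation index_pair: pair_sigma_finite "count_space {1::nat..}" M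
  by (intro pair_sigma_finite.intro sigma_finite_measure_count_space sigma_finite_measure_axioms)

text \<open>Sums over the random range up to \<open>N T\<close> become integrals over all indices
  with this weight, so that sum and expectation can be exchanged. The comparison is made in
  \<open>ennreal\<close>, which discards infinite points.\<close>

definition points_indicator :: "nat \<Rightarrow> 'w \<Rightarrow> ennreal" where
  "points_indicator i \<omega> = indicator {..ennreal T} (pts i \<omega>)"

lemma points_indicator_measurable [measurable (raw)]:
  "1 \<le> i \<Longrightarrow> points_indicator i \<in> borel_measurable M"
  using pts_measurable unfolding points_indicator_def by measurable

text \<open>The quantifier over \<open>f\<close> stands inside the almost sure statement: the
  exceptional set is common to all \<open>f\<close>, which may therefore depend on \<omega>, as the
  marks do.\<close>

lemma nn_integral_points_eq_sum:
  "AE \<omega> in M. \<forall>f. (\<integral>\<^sup>+i. points_indicator i \<omega> * f i \<partial>count_space {1..}) = (\<Sum>i=1..N T \<omega>. f i)"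
  using AE_points_eq
proof eventually_elim
  case (elim \<omega>)
  have mem: "1 \<le> i \<and> pts i \<omega> \<le> ennreal T \<longleftrightarrow> i \<in> {1..N T \<omega>}" for i
    using elim by (simp only: set_eq_iff mem_Collect_eq)
  have in_range: "points_indicator i \<omega> = 1" if "i \<in> {1..N T \<omega>}" for i
    using mem[of i] that by (simp add: points_indicator_def)
  have out_of_range: "points_indicator i \<omega> = 0" if "i \<in> {1..}" "i \<notin> {1..N T \<omega>}" for i
    using mem[of i] that by (simp add: points_indicator_def indicator_def)
  have "(\<integral>\<^sup>+i. points_indicator i \<omega> * f i \<partial>count_space {1..}) = (\<Sum>i=1..N T \<omega>. points_indicator i \<omega> * f i)" for f
    by (rule nn_integral_count_space') (simp_all add: out_of_range subset_eq del: One_nat_def)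
  moreover have "(\<Sum>i=1..N T \<omega>. points_indicator i \<omega> * f i) = (\<Sum>i=1..N T \<omega>. f i)" for f
    by (rule sum.cong) (simp_all only: in_range mult_1)
  ultimately show ?case by simp
qed

lemma nn_integral_points_Ioi:
  assumes "0 \<le> t" "t \<le> T"
  shows "AE \<omega> in M. (\<integral>\<^sup>+i. points_indicator i \<omega> * indicator {t<..} (enn2real (pts i \<omega>)) \<partial>count_space {1..})
      = of_nat (N T \<omega> - N t \<omega>)"
  using AE_finite_points[OF order_refl]
proof eventually_elim
  case (elim \<omega>)
  let ?S = "\<lambda>t. {i. 1 \<le> i \<and> pts i \<omega> \<le> ennreal t}"
  have sub: "?S t \<subseteq> ?S T"
    using assms by (auto intro: order_trans ennreal_leI)
  have fin: "finite (?S t)"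
    using elim sub by (rule rev_finite_subset)
  \<comment> \<open>\<open>enn2real\<close> sends infinity to 0, where the equivalence fails; the
    bound by \<open>T\<close> excludes infinite points.\<close>
  have iff: "t < enn2real z \<longleftrightarrow> \<not> z \<le> ennreal t" if "z \<le> ennreal T" for z
    using that assms by (cases z) (auto simp: top_unique)
  have "(\<integral>\<^sup>+i. points_indicator i \<omega> * indicator {t<..} (enn2real (pts i \<omega>)) \<partial>count_space {1..})
      = (\<integral>\<^sup>+i. indicator (?S T - ?S t) i \<partial>count_space {1..})"
    by (intro nn_integral_cong) (auto simp: points_indicator_def indicator_def iff)
  also have "\<dots> = of_nat (card (?S T - ?S t))"
    using elim by (subst nn_integral_indicator) (auto intro!: emeasure_count_space_finite)
  also have "card (?S T - ?S t) = N T \<omega> - N t \<omega>"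
    unfolding point_count_def by (rule card_Diff_subset[OF fin sub])
  finally show ?case .
qed

text \<open>Both sides integrate \<phi> against a finite measure on the line: the mean measure of
  the points on the event of total \<open>n\<close>, and a multiple of the intensity cut to
  \<open>{0..T}\<close>. Half-lines determine such measures, and on them the claim is the mean
  increment already computed.\<close>

lemma campbell_given_total:
  assumes \<phi>: "\<phi> \<in> borel_measurable borel"
  shows "(\<integral>\<^sup>+\<omega>. indicator {n} (N T \<omega>) * (\<integral>\<^sup>+i. points_indicator i \<omega> * \<phi> (enn2real (pts i \<omega>)) \<partial>count_space {1..}) \<partial>M)
    = ennreal (poisson_weight n * n / m) * (\<integral>\<^sup>+s. ennreal (lam s) * indicator {0..T} s * \<phi> s \<partial>lborel)"
proof -
  note [measurable] = lam_measurable
  define P where "P = count_space {1::nat..} \<Otimes>\<^sub>M M"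
  define d where "d = (\<lambda>(i, \<omega>). indicator {n} (N T \<omega>) * points_indicator i \<omega>)"
  define z where "z = (\<lambda>(i, \<omega>). enn2real (pts i \<omega>))"
  define c where "c = ennreal (poisson_weight n * n / m)"
  have d: "d \<in> borel_measurable P"
    unfolding d_def P_def
    by (intro points_pair_measurable borel_measurable_times_ennreal function_of_N_measurable
        points_indicator_measurable)
  have z: "z \<in> borel_measurable P"
    unfolding z_def P_def using pts_measurable by (intro points_pair_measurable) measurable
  note [measurable] = d z
  \<comment> \<open>Pairs of an index and an outcome, weighted by \<open>d\<close>, are pushed to
    the position of the point, so \<open>K\<close> gives a set the mean number of points in it on
    the event of total \<open>n\<close>.\<close>
  define K where "K = distr (density P d) borel z"
  define L where "L = density lborel (\<lambda>s. c * (ennreal (lam s) * indicator {0..T} s))"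
  have K: "(\<integral>\<^sup>+s. f s \<partial>K)
      = (\<integral>\<^sup>+\<omega>. indicator {n} (N T \<omega>) * (\<integral>\<^sup>+i. points_indicator i \<omega> * f (enn2real (pts i \<omega>)) \<partial>count_space {1..}) \<partial>M)"
    if f [measurable]: "f \<in> borel_measurable borel" for f
  proof -
    have "(\<integral>\<^sup>+s. f s \<partial>K) = (\<integral>\<^sup>+x. d x * f (z x) \<partial>P)"
      unfolding K_def by (simp add: nn_integral_distr nn_integral_density)
    also have "\<dots> = (\<integral>\<^sup>+\<omega>. (\<integral>\<^sup>+i. d (i, \<omega>) * f (z (i, \<omega>)) \<partial>count_space {1..}) \<partial>M)"
      unfolding P_def by (rule index_pair.nn_integral_snd[symmetric]) (fold P_def, measurable)
    finally show ?thesis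
      by (simp add: d_def z_def nn_integral_cmult mult.assoc)
  qed
  have L: "(\<integral>\<^sup>+s. f s \<partial>L) = c * (\<integral>\<^sup>+s. ennreal (lam s) * indicator {0..T} s * f s \<partial>lborel)"
    if f [measurable]: "f \<in> borel_measurable borel" for f
  proof -
    have "(\<integral>\<^sup>+s. f s \<partial>L) = (\<integral>\<^sup>+s. c * (ennreal (lam s) * indicator {0..T} s * f s) \<partial>lborel)"
      unfolding L_def by (subst nn_integral_density) (simp_all add: mult.assoc)
    also have "\<dots> = c * (\<integral>\<^sup>+s. ennreal (lam s) * indicator {0..T} s * f s \<partial>lborel)"
      by (rule nn_integral_cmult) measurable
    finally show ?thesis .
  qed
  have c: "c < \<infinity>"
    by (simp add: c_def)
  have at: "(\<integral>\<^sup>+s. indicator {t<..} s \<partial>K) = c * (\<Lambda> T - \<Lambda> t)" if t: "0 \<le> t" "t \<le> T" for t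
  proof -
    have "(\<integral>\<^sup>+s. indicator {t<..} s \<partial>K) = (\<integral>\<^sup>+\<omega>. indicator {n} (N T \<omega>) * of_nat (N T \<omega> - N t \<omega>) \<partial>M)"
      unfolding K[OF borel_measurable_indicator[OF borel_open[OF open_greaterThan]]]
      using nn_integral_points_Ioi[OF t] by (intro nn_integral_cong_AE) (auto elim!: eventually_mono)
    then show ?thesis
      unfolding nn_integral_increment_given_total[OF t] c_def .
  qed
  have eq: "(\<integral>\<^sup>+s. indicator {t<..} s \<partial>K) = (\<integral>\<^sup>+s. indicator {t<..} s \<partial>L)" for t :: real
  proof -
    consider "t < 0" | "0 \<le> t" "t \<le> T" | "T < t" by linarith
    then show ?thesis
    proof cases
      \<comment> \<open>The half-line holds every position, and almost surely N(0) = 0, so the count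
        is N(T) - N(0).\<close>
      case 1
      have "(\<integral>\<^sup>+s. indicator {t<..} s \<partial>K)
          = (\<integral>\<^sup>+\<omega>. indicator {n} (N T \<omega>) * (\<Sum>i=1..N T \<omega>. 1) \<partial>M)"
        unfolding K[OF borel_measurable_indicator[OF borel_open[OF open_greaterThan]]]
      proof (rule nn_integral_cong_AE)
        have t: "t < enn2real z" for z using 1 by (meson enn2real_nonneg order_less_le_trans)
        show "AE \<omega> in M. indicator {n} (N T \<omega>) *
            (\<integral>\<^sup>+i. points_indicator i \<omega> * indicator {t<..} (enn2real (pts i \<omega>)) \<partial>count_space {1..})
          = indicator {n} (N T \<omega>) * (\<Sum>i=1..N T \<omega>. 1)"
          using nn_integral_points_eq_sum
        proof eventually_elim
          case (elim \<omega>)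
          show ?case
            using elim[rule_format, of "\<lambda>_. 1"] t by simp
        qed
      qed
      also have "\<dots> = (\<integral>\<^sup>+\<omega>. indicator {n} (N T \<omega>) * of_nat (N T \<omega> - N 0 \<omega>) \<partial>M)"
        using AE_N_0 by (intro nn_integral_cong_AE) (auto elim!: eventually_mono)
      also have "\<dots> = c * \<Lambda> T"
        using nn_integral_increment_given_total[of 0] T_pos by (simp add: c_def \<Lambda>_0)
      also have "\<dots> = (\<integral>\<^sup>+s. indicator {t<..} s \<partial>L)"
        unfolding L[OF borel_measurable_indicator[OF borel_open[OF open_greaterThan]]]
          cumulative_intensity_def
        using 1 by (intro arg_cong[where f = "(*) c"] nn_integral_cong) (auto simp: indicator_def)
      finally show ?thesis .
    next
      case 2
      show ?thesis
        unfolding at[OF 2] L[OF borel_measurable_indicator[OF borel_open[OF open_greaterThan]]]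
          intensity_Ioi[OF 2] ..
    next
      \<comment> \<open>Beyond \<open>T\<close> both measures vanish; for \<open>K\<close> by
        comparison with the half-line starting at \<open>T\<close>, whose mass is 0.\<close>
      case 3
      have "(\<integral>\<^sup>+s. indicator {t<..} s \<partial>K) \<le> (\<integral>\<^sup>+s. indicator {T<..} s \<partial>K)"
        using 3 by (intro nn_integral_mono) (auto simp: indicator_def)
      also have "\<dots> = 0"
        using at[of T] T_pos m_finite by (simp add: ennreal_diff_self)
      finally have "(\<integral>\<^sup>+s. indicator {t<..} s \<partial>K) = 0" by simp
      moreover have "(\<integral>\<^sup>+s. ennreal (lam s) * indicator {0..T} s * indicator {t<..} s \<partial>lborel) = (\<integral>\<^sup>+s. 0 \<partial>(lborel :: real measure))"
        using 3 by (intro nn_integral_cong) (auto simp: indicator_def)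
      ultimately show ?thesis
        unfolding L[OF borel_measurable_indicator[OF borel_open[OF open_greaterThan]]] by simp
    qed
  qed
  have sets: "sets K = sets borel" "sets L = sets borel"
    by (simp_all add: K_def L_def)
  have "K = L"
  proof (rule measure_eqI_lessThan[OF sets])
    fix t :: real
    have "(\<integral>\<^sup>+s. indicator {t<..} s \<partial>L) \<le> c * \<Lambda> T"
      unfolding L[OF borel_measurable_indicator[OF borel_open[OF open_greaterThan]]] cumulative_intensity_def
      by (intro mult_left_mono nn_integral_mono) (auto simp: indicator_def)
    also have "\<dots> < \<infinity>"
      using c m_finite by (simp add: ennreal_mult_less_top)
    finally show "emeasure K {t<..} < \<infinity>"
      using eq[of t] by (simp add: sets)
    show "emeasure K {t<..} = emeasure L {t<..}"
      using eq[of t] by (simp add: sets)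
  qed
  then show ?thesis
    using K[OF \<phi>] L[OF \<phi>] by (simp add: c_def)
qed

text \<open>On each event of fixed total the mean measure is a multiple of the same intensity, so a
  weight depending on the total factors out. The series is the mean of \<open>g\<close> under the
  size-biased Poisson law.\<close>

lemma campbell:
  fixes g :: "nat \<Rightarrow> ennreal"
  assumes \<phi> [measurable]: "\<phi> \<in> borel_measurable borel"
  shows "(\<integral>\<^sup>+\<omega>. g (N T \<omega>) * (\<integral>\<^sup>+i. points_indicator i \<omega> * \<phi> (enn2real (pts i \<omega>)) \<partial>count_space {1..}) \<partial>M)
    = (\<Sum>n. g n * ennreal (poisson_weight n * n / m))
        * (\<integral>\<^sup>+s. ennreal (lam s) * indicator {0..T} s * \<phi> s \<partial>lborel)"
proof -
  define S where "S = (\<lambda>\<omega>. \<integral>\<^sup>+i. points_indicator i \<omega> * \<phi> (enn2real (pts i \<omega>)) \<partial>count_space {1..})"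
  have "(\<lambda>(i, \<omega>). points_indicator i \<omega> * \<phi> (enn2real (pts i \<omega>))) \<in> borel_measurable (count_space {1..} \<Otimes>\<^sub>M M)"
    using pts_measurable by (intro points_pair_measurable) measurable
  then have S [measurable]: "S \<in> borel_measurable M"
    unfolding S_def by measurable
  have [measurable]: "(\<lambda>\<omega>. indicator {n} (N T \<omega>) :: ennreal) \<in> borel_measurable M" for n
    by (rule function_of_N_measurable)
  \<comment> \<open>A series with at most one nonzero term selects the value of the total; it can
    then be exchanged with the expectation.\<close>
  have single: "(\<Sum>n. g n * (indicator {n} k * s)) = g k * s" for k s
    by (subst suminf_finite[of "{k}"]) auto
  have "(\<integral>\<^sup>+\<omega>. g (N T \<omega>) * S \<omega> \<partial>M) = (\<integral>\<^sup>+\<omega>. (\<Sum>n. g n * (indicator {n} (N T \<omega>) * S \<omega>)) \<partial>M)"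
    by (simp only: single)
  also have "\<dots> = (\<Sum>n. g n * (\<integral>\<^sup>+\<omega>. indicator {n} (N T \<omega>) * S \<omega> \<partial>M))"
    by (subst nn_integral_suminf) (simp_all add: nn_integral_cmult)
  also have "\<dots> = (\<Sum>n. g n * ennreal (poisson_weight n * n / m)
        * (\<integral>\<^sup>+s. ennreal (lam s) * indicator {0..T} s * \<phi> s \<partial>lborel))"
    unfolding S_def campbell_given_total[OF \<phi>] by (simp only: mult.assoc)
  finally show ?thesis
    unfolding S_def by simp
qed

section \<open>Moments of the size-biased Poisson law\<close>

lemma poisson_weight_nonneg: "0 \<le> poisson_weight n"
  using m_gt_0 by (simp add: poisson_weight_def)

text \<open>Size-biasing shifts a Poisson law by one: the new weight at n + 1 is the Poisson weight
  at \<open>n\<close>, and the exponential series gives the mass.\<close>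

lemma size_biased_sums: "(\<Sum>n. ennreal (poisson_weight n * n / m)) = 1"
proof -
  have "(\<lambda>n. exp (- m) * (m ^ n /\<^sub>R fact n)) sums (exp (- m) * exp m)"
    by (intro sums_mult exp_converges)
  moreover have "exp (- m) * (m ^ n /\<^sub>R fact n) = poisson_weight (Suc n) * real (Suc n) / m" for n
    using m_gt_0 by (simp add: poisson_weight_def field_simps del: of_nat_Suc)
  ultimately have "(\<lambda>n. poisson_weight (Suc n) * real (Suc n) / m) sums 1"
    by (simp add: exp_minus del: of_nat_Suc)
  then have "(\<lambda>n. poisson_weight n * real n / m) sums (1 + poisson_weight 0 * real 0 / m)"
    by (rule sums_Suc)
  then have sums: "(\<lambda>n. poisson_weight n * real n / m) sums 1"
    by simp
  have "0 \<le> poisson_weight n * real n / m" for n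
    using m_gt_0 poisson_weight_nonneg[of n] by simp
  from suminf_ennreal_eq[OF this sums] show ?thesis
    by (simp only: ennreal_1)
qed

text \<open>Absorbs the factor n^p produced by the union bound. A power of \<open>n\<close> is at
  most a constant times e^n, so the series is dominated by the exponential series at
  \<open>m * exp 1\<close>.\<close>

lemma size_biased_moment_finite:
  "(\<Sum>n. ennreal (real n powr p) * ennreal (poisson_weight n * n / m)) < \<infinity>"
proof -
  define k where "k = nat \<lceil>p\<rceil>"
  \<comment> \<open>The factorial comes from n^(k+1) \<le> (k+1)! e^n, where \<open>Suc k\<close>
    makes room for the size-biasing factor \<open>n\<close> besides
    \<open>real n powr p\<close>.\<close>
  define c where "c = fact (Suc k) * exp (- m) / m"
  have bound: "real n powr p * (poisson_weight n * n / m) \<le> c * ((m * exp 1) ^ n /\<^sub>R fact n)" for n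
  proof (cases "n = 0")
    case True
    then show ?thesis using m_gt_0 by (simp add: c_def)
  next
    case False
    have "real n powr p \<le> real n powr real k"
      using False by (intro powr_mono) (auto simp: k_def, linarith)
    then have "real n powr p * real n \<le> real n ^ Suc k"
      using False by (simp add: powr_realpow)
    also have "\<dots> \<le> fact (Suc k) * exp (real n)"
      by (rule power_le_fact_exp) simp
    finally have "real n powr p * real n * (m ^ n / fact n * exp (- m) / m)
        \<le> fact (Suc k) * exp (real n) * (m ^ n / fact n * exp (- m) / m)"
      using m_gt_0 by (intro mult_right_mono) auto
    moreover have "exp (real n) = exp 1 ^ n"
      by (simp add: exp_of_nat_mult[symmetric])
    ultimately show ?thesis
      by (simp add: poisson_weight_def c_def field_simps power_mult_distrib)
  qed
  have "summable (\<lambda>n. c * ((m * exp 1) ^ n /\<^sub>R fact n))"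
    by (intro summable_mult summable_exp_generic)
  then have "summable (\<lambda>n. real n powr p * (poisson_weight n * n / m))"
    by (rule summable_comparison_test'[where N = 0])
      (use bound m_gt_0 poisson_weight_nonneg in \<open>auto simp: abs_mult\<close>)
  then have sums: "(\<lambda>n. real n powr p * (poisson_weight n * n / m)) sums
      (\<Sum>n. real n powr p * (poisson_weight n * n / m))"
    by (rule summable_sums)
  have "0 \<le> real n powr p * (poisson_weight n * n / m)" for n
    using m_gt_0 poisson_weight_nonneg[of n] by simp
  then show ?thesis
    unfolding ennreal_mult'[OF powr_ge_zero, symmetric] by (subst suminf_ennreal_eq[OF _ sums]) simp_all
qed

text \<open>Each mark is independent of the whole point sequence, so index by index its power may be
  replaced by the moment at the position of the point. Resummed, this depends on positions alone and
  the unmarked formula applies.\<close>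

lemma marked_campbell:
  fixes g :: "nat \<Rightarrow> ennreal" and H :: "nat \<Rightarrow> 'w \<Rightarrow> real \<Rightarrow> real"
  assumes G: "nonneg_function_space borel G"
    and H: "\<And>i. 1 \<le> i \<Longrightarrow> distr M G (H i) = \<mu>"
    and ind: "independent_rvs M (Pi\<^sub>M {1..} (\<lambda>_. G)) (\<lambda>\<omega>. \<lambda>i\<in>{1..}. H i \<omega>)
        (Pi\<^sub>M {1..} (\<lambda>_. borel)) (\<lambda>\<omega>. \<lambda>i\<in>{1..}. pts i \<omega>)"
  shows "(\<integral>\<^sup>+\<omega>. g (N T \<omega>) * (\<Sum>i=1..N T \<omega>. ennreal (H i \<omega> (enn2real (pts i \<omega>)) powr q)) \<partial>M)
    = (\<Sum>n. g n * ennreal (poisson_weight n * n / m))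
        * (\<integral>\<^sup>+s. ennreal (lam s) * indicator {0..T} s * power_moment \<mu> q s \<partial>lborel)"
proof -
  let ?B = "Pi\<^sub>M {1::nat..} (\<lambda>_. borel :: ennreal measure)"
  let ?Z = "\<lambda>\<omega>. \<lambda>i\<in>{1..}. pts i \<omega>"
  have ind_i: "independent_rvs M G (H i) ?B ?Z" if "1 \<le> i" for i
  proof -
    have "(\<lambda>k. k i) \<in> Pi\<^sub>M {1..} (\<lambda>_. G) \<rightarrow>\<^sub>M G"
      using that by (intro measurable_component_singleton) auto
    from independent_rvs_compose_left[OF prob_space_axioms ind this] that show ?thesis
      by simp
  qed
  have H_meas: "H i \<in> M \<rightarrow>\<^sub>M G" if "1 \<le> i" for i
    using ind_i[OF that] by (simp add: independent_rvs_def)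
  have "prob_space \<mu>" "sets \<mu> = sets G"
    using H[OF order_refl] prob_space_distr[OF H_meas[OF order_refl]] by auto
  then have \<phi>: "power_moment \<mu> q \<in> borel_measurable borel"
    by (intro power_moment_measurable[OF G] prob_space_imp_sigma_finite)
  note [measurable] = \<phi>
  define a where "a = (\<lambda>i \<omega>. ennreal (H i \<omega> (enn2real (pts i \<omega>)) powr q))"
  define b where "b = (\<lambda>i \<omega>. power_moment \<mu> q (enn2real (pts i \<omega>)))"
  have a: "a i \<in> borel_measurable M" if "1 \<le> i" for i
  proof -
    have "(\<lambda>\<omega>. (H i \<omega>, enn2real (pts i \<omega>))) \<in> M \<rightarrow>\<^sub>M G \<Otimes>\<^sub>M borel"
      using H_meas[OF that] pts_measurable[OF that] by measurable
    from measurable_compose[OF this nonneg_function_space_powr_measurable[OF G, of q]] show ?thesis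
      by (simp add: a_def)
  qed
  have b: "b i \<in> borel_measurable M" if "1 \<le> i" for i
    unfolding b_def using pts_measurable[OF that] by measurable
  have int_i: "(\<integral>\<^sup>+\<omega>. g (N T \<omega>) * (points_indicator i \<omega> * a i \<omega>) \<partial>M)
      = (\<integral>\<^sup>+\<omega>. g (N T \<omega>) * (points_indicator i \<omega> * b i \<omega>) \<partial>M)" if i: "1 \<le> i" for i
  proof -
    \<comment> \<open>The count is rewritten as a function of the point sequence, so that
      \<open>g (N T \<omega>)\<close> and the indicator of the i-th point form one factor
      \<open>u\<close> that is frozen together with the points.\<close>
    define cnt where "cnt = point_count (\<lambda>i (\<tau> :: nat \<Rightarrow> ennreal). \<tau> i) T"
    define u where "u = (\<lambda>\<tau>. g (cnt \<tau>) * indicator {..ennreal T} (\<tau> i))"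
    have coord [measurable]: "(\<lambda>\<tau>. \<tau> j) \<in> borel_measurable ?B" if "1 \<le> j" for j
      using that by (intro measurable_component_singleton) auto
    have "cnt \<in> ?B \<rightarrow>\<^sub>M count_space UNIV"
      unfolding cnt_def point_count_def
    proof (rule measurable_card)
      fix j show "{\<tau> \<in> space ?B. j \<in> {i. 1 \<le> i \<and> \<tau> i \<le> ennreal T}} \<in> sets ?B"
      proof (cases "1 \<le> j")
        case True
        note [measurable] = coord[OF this]
        show ?thesis using True by simp
      qed simp
    qed
    then have "(\<lambda>\<tau>. g (cnt \<tau>)) \<in> borel_measurable ?B"
      by (rule measurable_compose) simp
    then have u: "u \<in> borel_measurable ?B"
      unfolding u_def using coord[OF i] by measurable
    have s: "(\<lambda>\<tau>. enn2real (\<tau> i)) \<in> borel_measurable ?B"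
      using coord[OF i] by measurable
    have N: "N T \<omega> = cnt (?Z \<omega>)" for \<omega>
      unfolding cnt_def point_count_def by (intro arg_cong[where f = card]) auto
    show ?thesis
      unfolding points_indicator_def a_def b_def N
      using nn_integral_evaluate_independent[OF prob_space_axioms ind_i[OF i] G s u, of q] i H[OF i]
      by (simp add: u_def mult.assoc)
  qed
  \<comment> \<open>Tonelli in the index and the outcome, used once in each direction around the
    replacement of \<open>a\<close> by \<open>b\<close>.\<close>
  have swap: "(\<integral>\<^sup>+\<omega>. g (N T \<omega>) * (\<integral>\<^sup>+i. points_indicator i \<omega> * f i \<omega> \<partial>count_space {1..}) \<partial>M)
      = (\<integral>\<^sup>+i. (\<integral>\<^sup>+\<omega>. g (N T \<omega>) * (points_indicator i \<omega> * f i \<omega>) \<partial>M) \<partial>count_space {1..})"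
    if f: "\<And>i. 1 \<le> i \<Longrightarrow> f i \<in> borel_measurable M" for f :: "nat \<Rightarrow> 'w \<Rightarrow> ennreal"
  proof -
    have "(\<integral>\<^sup>+\<omega>. g (N T \<omega>) * (\<integral>\<^sup>+i. points_indicator i \<omega> * f i \<omega> \<partial>count_space {1..}) \<partial>M)
        = (\<integral>\<^sup>+\<omega>. (\<integral>\<^sup>+i. g (N T \<omega>) * (points_indicator i \<omega> * f i \<omega>) \<partial>count_space {1..}) \<partial>M)"
      by (simp add: nn_integral_cmult)
    also have "\<dots> = (\<integral>\<^sup>+i. (\<integral>\<^sup>+\<omega>. g (N T \<omega>) * (points_indicator i \<omega> * f i \<omega>) \<partial>M) \<partial>count_space {1..})"
      using f by (intro index_pair.Fubini' points_pair_measurable borel_measurable_times_ennreal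
          function_of_N_measurable points_indicator_measurable)
    finally show ?thesis .
  qed
  have "(\<integral>\<^sup>+\<omega>. g (N T \<omega>) * (\<Sum>i=1..N T \<omega>. a i \<omega>) \<partial>M)
      = (\<integral>\<^sup>+\<omega>. g (N T \<omega>) * (\<integral>\<^sup>+i. points_indicator i \<omega> * a i \<omega> \<partial>count_space {1..}) \<partial>M)"
    by (rule nn_integral_cong_AE) (use nn_integral_points_eq_sum in \<open>auto elim!: eventually_mono\<close>)
  also have "\<dots> = (\<integral>\<^sup>+i. (\<integral>\<^sup>+\<omega>. g (N T \<omega>) * (points_indicator i \<omega> * a i \<omega>) \<partial>M) \<partial>count_space {1..})"
    by (rule swap[OF a])
  also have "\<dots> = (\<integral>\<^sup>+i. (\<integral>\<^sup>+\<omega>. g (N T \<omega>) * (points_indicator i \<omega> * b i \<omega>) \<partial>M) \<partial>count_space {1..})"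
    by (rule nn_integral_cong) (simp add: int_i)
  also have "\<dots> = (\<integral>\<^sup>+\<omega>. g (N T \<omega>) * (\<integral>\<^sup>+i. points_indicator i \<omega> * b i \<omega> \<partial>count_space {1..}) \<partial>M)"
    by (rule swap[OF b, symmetric])
  finally show ?thesis
    unfolding a_def b_def campbell[OF \<phi>] .
qed

lemma nn_integral_N: "(\<integral>\<^sup>+\<omega>. of_nat (N T \<omega>) \<partial>M) = \<Lambda> T"
proof -
  have "(\<integral>\<^sup>+\<omega>. of_nat (N T \<omega>) \<partial>M)
      = (\<integral>\<^sup>+\<omega>. 1 * (\<integral>\<^sup>+i. points_indicator i \<omega> * 1 \<partial>count_space {1..}) \<partial>M)"
  proof (rule nn_integral_cong_AE)
    show "AE \<omega> in M. of_nat (N T \<omega>) = 1 * (\<integral>\<^sup>+i. points_indicator i \<omega> * 1 \<partial>count_space {1..})"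
      using nn_integral_points_eq_sum
    proof eventually_elim
      case (elim \<omega>)
      from elim[rule_format, of "\<lambda>_. 1"] show ?case by simp
    qed
  qed
  also have "\<dots> = \<Lambda> T"
    using campbell[of "\<lambda>_. 1" "\<lambda>_. 1"] by (simp add: size_biased_sums cumulative_intensity_def)
  finally show ?thesis .
qed

end

section \<open>Shot noise\<close>

theorem corollary12:
  fixes M :: "'w measure" and M' :: "'v measure"
    and X :: "nat \<Rightarrow> 'w \<Rightarrow> real"
    and h :: "nat \<Rightarrow> 'w \<Rightarrow> real \<times> real \<Rightarrow> real"
    and pts :: "nat \<Rightarrow> 'w \<Rightarrow> ennreal"
    and F :: "(real \<times> real \<Rightarrow> real) measure" and G :: "(real \<Rightarrow> real) measure"
    and lam :: "real \<Rightarrow> real"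
    and h0 :: "'v \<Rightarrow> real \<times> real \<Rightarrow> real" and V0 :: "'v \<Rightarrow> real"
    and T \<alpha> p :: real and \<gamma> :: ennreal
  assumes "prob_space M" and "prob_space M'"
    and T_pos: "T > 0" and \<alpha>_pos: "\<alpha> > 0" and p_gt: "p > \<alpha>"
    and points: "poisson_process M lam pts"
    and m_pos: "0 < cumulative_intensity lam T" and m_finite: "cumulative_intensity lam T < \<infinity>"
    and X_rv: "\<forall>i\<ge>1. X i \<in> borel_measurable M"
    and X_nonneg: "\<forall>i\<ge>1. AE \<omega> in M. 0 \<le> X i \<omega>"
    and F_space: "nonneg_function_space (borel \<Otimes>\<^sub>M borel) F"
    and h_iid: "iid M F h"
    and X_indep: "independent_rvs M
        (Pi\<^sub>M {1..} (\<lambda>_. borel)) (\<lambda>\<omega>. \<lambda>i\<in>{1..}. X i \<omega>)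
        (Pi\<^sub>M {1..} (\<lambda>_. F) \<Otimes>\<^sub>M Pi\<^sub>M {1..} (\<lambda>_. borel))
        (\<lambda>\<omega>. (\<lambda>i\<in>{1..}. h i \<omega>, \<lambda>i\<in>{1..}. pts i \<omega>))"
    and X_ident: "\<forall>i\<ge>1. distr M borel (X i) = distr M borel (X 1)"
    and X_mean: "\<forall>i\<ge>1. (\<integral>\<^sup>+\<omega>. ennreal (X i \<omega>) \<partial>M) = \<gamma>"
    and X_tail: "regularly_varying (\<lambda>x. measure M {\<omega> \<in> space M. X 1 \<omega> > x}) (- \<alpha>)"
    and X_joint_tail:
      "((\<lambda>x. SUP (i, j) \<in> {(i, j). 1 \<le> i \<and> 1 \<le> j \<and> i \<noteq> j}.
           measure M {\<omega> \<in> space M. X i \<omega> > x \<and> X j \<omega> > x} /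
           measure M {\<omega> \<in> space M. X 1 \<omega> > x}) \<longlongrightarrow> 0) at_top"
    and G_space: "nonneg_function_space borel G"
    and section_measurable: "(\<lambda>f s. f (T, s)) \<in> F \<rightarrow>\<^sub>M G"
    and h_T_iid: "iid M G (\<lambda>i \<omega> s. h i \<omega> (T, s))"
    and h_T_indep: "independent_rvs M
        (Pi\<^sub>M {1..} (\<lambda>_. G)) (\<lambda>\<omega>. \<lambda>i\<in>{1..}. \<lambda>s. h i \<omega> (T, s))
        (Pi\<^sub>M {1..} (\<lambda>_. borel)) (\<lambda>\<omega>. \<lambda>i\<in>{1..}. pts i \<omega>)"
    and h0_copy: "h0 \<in> M' \<rightarrow>\<^sub>M F" "distr M' F h0 = distr M F (h 1)"
    and V0_density: "distributed M' lborel V0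
        (\<lambda>t. ennreal (lam t) * indicator {0..T} t / cumulative_intensity lam T)"
    and h0_V0_indep: "independent_rvs M' F h0 borel V0"
    and h_moment: "integrable M' (\<lambda>\<omega>. h0 \<omega> (T, V0 \<omega>) powr p)"
  shows "((\<lambda>x. measure M {\<omega> \<in> space M. shot_noise X h pts T \<omega> > x} /
                measure M {\<omega> \<in> space M. X 1 \<omega> > x})
           \<longlongrightarrow> enn2real (cumulative_intensity lam T) *
               (\<integral>\<omega>. h0 \<omega> (T, V0 \<omega>) powr \<alpha> \<partial>M')) at_top"
proof -
  interpret M: prob_space M by fact
  interpret M': prob_space M' by fact
  interpret X: asymptotically_independent M X \<alpha>
  proof unfold_locales
    show "X i \<in> borel_measurable M" "AE \<omega> in M. 0 \<le> X i \<omega>" "distr M borel (X i) = distr M borel (X 1)"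
      if "1 \<le> i" for i
      using X_rv X_nonneg X_ident that by blast+
  qed (fact \<alpha>_pos X_tail X_joint_tail)+
  interpret pp: poisson_points M lam pts T
    by unfold_locales (fact points T_pos m_pos m_finite)+
  define H where "H = (\<lambda>i \<omega> s. h i \<omega> (T, s))"
  define \<mu> where "\<mu> = distr M G (H 1)"
  have H_indep_vars: "M.indep_vars (\<lambda>_. G) H {1..}"
    and H_ident: "\<forall>i\<ge>1. distr M G (H i) = distr M G (H 1)"
    using h_T_iid[folded H_def, unfolded iid_def] by (rule conjunct1, rule conjunct2)
  have H_meas: "H i \<in> M \<rightarrow>\<^sub>M G" if "1 \<le> i" for i
    using H_indep_vars that by (simp only: M.indep_vars_def2 atLeast_iff)
  have H_distr: "distr M G (H i) = \<mu>" if "1 \<le> i" for i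
    unfolding \<mu>_def using H_ident that by blast
  have H_indep: "independent_rvs M (Pi\<^sub>M {1..} (\<lambda>_. G)) (\<lambda>\<omega>. \<lambda>i\<in>{1..}. H i \<omega>)
      (Pi\<^sub>M {1..} (\<lambda>_. borel)) (\<lambda>\<omega>. \<lambda>i\<in>{1..}. pts i \<omega>)"
    using h_T_indep unfolding H_def .
  have \<mu>: "prob_space \<mu>" "sets \<mu> = sets G"
    using M.prob_space_distr[OF H_meas[OF order_refl]] by (simp_all add: \<mu>_def)
  \<comment> \<open>The form in which the Campbell formula delivers m(T) E[h_0^q(T, V_0)]; q = p
    serves integrability and q = \<alpha> the limit.\<close>
  define J where "J = (\<lambda>q. \<integral>\<^sup>+s. ennreal (lam s) * indicator {0..T} s * power_moment \<mu> q s \<partial>lborel)"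
  have J_eq: "J q = cumulative_intensity lam T * (\<integral>\<^sup>+\<omega>. ennreal (h0 \<omega> (T, V0 \<omega>) powr q) \<partial>M')" for q
  proof -
    define H0 where "H0 = (\<lambda>\<omega> s. h0 \<omega> (T, s))"
    \<comment> \<open>Equality of the laws of \<open>h0\<close> and \<open>h 1\<close> passes to the
      sections at \<open>T\<close>, both being images under the same measurable section map.\<close>
    have H0_distr: "distr M' G H0 = \<mu>"
    proof -
      have h_meas: "h 1 \<in> M \<rightarrow>\<^sub>M F"
        using h_iid by (simp only: iid_def M.indep_vars_def2 atLeast_iff order_refl)
      have "distr M' G H0 = distr (distr M' F h0) G (\<lambda>f s. f (T, s))"
        by (simp add: distr_distr[OF section_measurable h0_copy(1)] comp_def H0_def)
      also have "\<dots> = distr M G (H 1)"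
        unfolding h0_copy(2) by (subst distr_distr[OF section_measurable h_meas]) (simp add: comp_def H_def)
      finally show ?thesis
        by (simp add: \<mu>_def)
    qed
    have ind: "independent_rvs M' G H0 borel V0"
      unfolding H0_def
      by (rule independent_rvs_compose_left[OF \<open>prob_space M'\<close> h0_V0_indep section_measurable])
    have \<phi>: "power_moment \<mu> q \<in> borel_measurable borel"
      by (intro power_moment_measurable[OF G_space] prob_space_imp_sigma_finite \<mu>)
    note [measurable] = \<phi> pp.lam_measurable
    have fin: "cumulative_intensity lam T \<noteq> 0" "cumulative_intensity lam T \<noteq> top"
      using m_pos m_finite by auto
    have "(\<integral>\<^sup>+\<omega>. ennreal (h0 \<omega> (T, V0 \<omega>) powr q) \<partial>M') = (\<integral>\<^sup>+\<omega>. power_moment \<mu> q (V0 \<omega>) \<partial>M')"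
      using nn_integral_evaluate_independent[OF \<open>prob_space M'\<close> ind G_space, of "\<lambda>s. s" "\<lambda>_. 1" q]
      by (simp add: H0_distr) (simp add: H0_def)
    also have "\<dots> = (\<integral>\<^sup>+s. ennreal (lam s) * indicator {0..T} s / cumulative_intensity lam T * power_moment \<mu> q s \<partial>lborel)"
      using \<phi> by (intro distributed_nn_integral[OF V0_density, symmetric]) simp
    also have "cumulative_intensity lam T * \<dots> = J q"
      unfolding J_def
    proof (subst nn_integral_cmult[symmetric])
      show "(\<lambda>s. ennreal (lam s) * indicator {0..T} s / cumulative_intensity lam T * power_moment \<mu> q s)
          \<in> borel_measurable lborel"
        by measurable
      \<comment> \<open>The division stems from the density of \<open>V0\<close>; cancelling it in
        \<open>ennreal\<close> needs m(T) to be neither 0 nor infinite.\<close>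
      have "c * (a / c * b) = a * b" if "c \<noteq> 0" "c \<noteq> top" for a b c :: ennreal
        using that by (metis ennreal_times_divide mult.assoc mult_divide_eq_ennreal mult.commute)
      then show "(\<integral>\<^sup>+s. cumulative_intensity lam T * (ennreal (lam s) * indicator {0..T} s
            / cumulative_intensity lam T * power_moment \<mu> q s) \<partial>lborel)
          = (\<integral>\<^sup>+s. ennreal (lam s) * indicator {0..T} s * power_moment \<mu> q s \<partial>lborel)"
        using fin by (intro nn_integral_cong) simp
    qed
    finally show ?thesis ..
  qed

  let ?B = "Pi\<^sub>M {1::nat..} (\<lambda>_. F) \<Otimes>\<^sub>M Pi\<^sub>M {1::nat..} (\<lambda>_. borel :: ennreal measure)"
  \<comment> \<open>Everything random apart from the shocks. Count and weights are read off from
    \<open>W\<close> by \<open>n\<close> and \<theta>, as functions on the product space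
    \<open>?B\<close>, where their measurability is checked.\<close>
  define W where "W = (\<lambda>\<omega>. (\<lambda>i\<in>{1..}. h i \<omega>, \<lambda>i\<in>{1..}. pts i \<omega>))"
  define \<theta> where "\<theta> = (\<lambda>i (w :: (nat \<Rightarrow> real \<times> real \<Rightarrow> real) \<times> (nat \<Rightarrow> ennreal)). fst w i (T, enn2real (snd w i)))"
  define n where "n = (\<lambda>w :: (nat \<Rightarrow> real \<times> real \<Rightarrow> real) \<times> (nat \<Rightarrow> ennreal). point_count (\<lambda>i \<tau>. \<tau> i) T (snd w))"
  have n_W: "n (W \<omega>) = point_count pts T \<omega>" for \<omega>
    unfolding n_def W_def point_count_def by (intro arg_cong[where f = card]) auto
  have \<theta>_W: "\<theta> i (W \<omega>) = H i \<omega> (enn2real (pts i \<omega>))" if "1 \<le> i" for i \<omega>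
    using that by (simp add: \<theta>_def W_def H_def)
  have W: "W \<in> M \<rightarrow>\<^sub>M ?B"
    using X_indep unfolding independent_rvs_def W_def by blast
  have pts_coord: "(\<lambda>w. snd w i) \<in> borel_measurable ?B" if "1 \<le> i" for i
    by (rule measurable_compose[OF measurable_snd measurable_component_singleton]) (use that in auto)
  have fun_coord: "(\<lambda>w. fst w i) \<in> ?B \<rightarrow>\<^sub>M F" if "1 \<le> i" for i
    by (rule measurable_compose[OF measurable_fst measurable_component_singleton]) (use that in auto)
  have n_meas: "n \<in> ?B \<rightarrow>\<^sub>M count_space UNIV"
    unfolding n_def point_count_def
  proof (rule measurable_card)
    fix j show "{w \<in> space ?B. j \<in> {i. 1 \<le> i \<and> snd w i \<le> ennreal T}} \<in> sets ?B"
    proof (cases "1 \<le> j")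
      case True
      note [measurable] = pts_coord[OF this]
      show ?thesis using True by simp
    qed simp
  qed
  have \<theta>_meas: "\<theta> i \<in> borel_measurable ?B" if "1 \<le> i" for i
  proof -
    have eval: "(\<lambda>(f, x). f x) \<in> borel_measurable (F \<Otimes>\<^sub>M (borel \<Otimes>\<^sub>M borel))"
      using F_space by (simp add: nonneg_function_space_def)
    note [measurable] = fun_coord[OF that] pts_coord[OF that]
    have "(\<lambda>w. (fst w i, (T, enn2real (snd w i)))) \<in> ?B \<rightarrow>\<^sub>M F \<Otimes>\<^sub>M (borel \<Otimes>\<^sub>M borel)"
      by measurable
    from measurable_compose[OF this eval] show ?thesis
      by (simp add: \<theta>_def)
  qed
  have \<theta>_nonneg: "0 \<le> \<theta> i w" if "1 \<le> i" "w \<in> space ?B" for i w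
    using F_space measurable_space[OF fun_coord[OF that(1)] that(2)]
    by (simp add: \<theta>_def nonneg_function_space_def)
  have sum_W: "(\<Sum>i=1..n (W \<omega>). ennreal (\<theta> i (W \<omega>) powr q))
      = (\<Sum>i=1..point_count pts T \<omega>. ennreal (H i \<omega> (enn2real (pts i \<omega>)) powr q))" for q \<omega>
    unfolding n_W by (intro sum.cong) (simp_all add: \<theta>_W)

  have marked_W: "(\<integral>\<^sup>+\<omega>. g (n (W \<omega>)) * (\<Sum>i=1..n (W \<omega>). ennreal (\<theta> i (W \<omega>) powr q)) \<partial>M)
      = (\<Sum>k. g k * ennreal (pp.poisson_weight k * k / pp.m)) * J q" for g q
    unfolding sum_W unfolding n_W J_def by (rule pp.marked_campbell[OF G_space H_distr H_indep])
  have power_sum_meas: "(\<lambda>\<omega>. \<Sum>i=1..n (W \<omega>). ennreal (\<theta> i (W \<omega>) powr q)) \<in> borel_measurable M" for q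
  proof (rule measurable_compose[OF W], intro measurable_random_sum n_meas)
    fix i :: nat assume "1 \<le> i"
    note [measurable] = \<theta>_meas[OF this]
    show "(\<lambda>w. ennreal (\<theta> i w powr q)) \<in> borel_measurable ?B" by measurable
  qed
  have J_finite: "J p < \<infinity>"
  proof -
    have "(\<integral>\<^sup>+\<omega>. ennreal (h0 \<omega> (T, V0 \<omega>) powr p) \<partial>M') < \<infinity>"
      using h_moment by (simp add: nn_integral_eq_integral)
    then show ?thesis
      using m_finite unfolding J_eq by (simp add: ennreal_mult_less_top)
  qed
  have V0_meas: "V0 \<in> borel_measurable M'"
    using h0_V0_indep by (simp add: independent_rvs_def)
  have h0_meas: "(\<lambda>\<omega>. h0 \<omega> (T, V0 \<omega>) powr \<alpha>) \<in> borel_measurable M'"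
  proof -
    have "(\<lambda>(f, x). f x) \<in> borel_measurable (F \<Otimes>\<^sub>M (borel \<Otimes>\<^sub>M borel))"
      using F_space by (simp add: nonneg_function_space_def)
    moreover have "(\<lambda>\<omega>. (h0 \<omega>, (T, V0 \<omega>))) \<in> M' \<rightarrow>\<^sub>M F \<Otimes>\<^sub>M (borel \<Otimes>\<^sub>M borel)"
      using h0_copy(1) V0_meas by measurable
    ultimately have [measurable]: "(\<lambda>\<omega>. h0 \<omega> (T, V0 \<omega>)) \<in> borel_measurable M'"
      by (auto dest: measurable_compose)
    show ?thesis by measurable
  qed
  have integrable: "integrable M (\<lambda>\<omega>. \<Sum>i=1..n (W \<omega>). 1 + (n (W \<omega>) * \<theta> i (W \<omega>)) powr p)"
  proof (rule integrableI_nonneg)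
    have "(\<lambda>w. \<Sum>i=1..n w. 1 + (n w * \<theta> i w) powr p) \<in> borel_measurable ?B"
    proof (intro measurable_random_sum n_meas)
      fix i :: nat assume "1 \<le> i"
      note [measurable] = \<theta>_meas[OF this] n_meas
      show "(\<lambda>w. 1 + (n w * \<theta> i w) powr p) \<in> borel_measurable ?B" by measurable
    qed
    then show "(\<lambda>\<omega>. \<Sum>i=1..n (W \<omega>). 1 + (n (W \<omega>) * \<theta> i (W \<omega>)) powr p) \<in> borel_measurable M"
      by (rule measurable_compose[OF W])
    show "AE \<omega> in M. 0 \<le> (\<Sum>i=1..n (W \<omega>). 1 + (n (W \<omega>) * \<theta> i (W \<omega>)) powr p)"
      by (intro AE_I2 sum_nonneg) (simp add: add_nonneg_nonneg)
    let ?g = "\<lambda>k. ennreal (real k powr p)"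
    let ?S = "\<lambda>\<omega>. \<Sum>i=1..n (W \<omega>). ennreal (\<theta> i (W \<omega>) powr p)"
    \<comment> \<open>Expanding the power splits the dominating sum into N(T), with mean m(T), and
      N(T)^p times the sum of the p-th powers of the weights, which is the marked formula with
      weight n^p.\<close>
    have "1 + (n (W \<omega>) * \<theta> i (W \<omega>)) powr p = 1 + n (W \<omega>) powr p * \<theta> i (W \<omega>) powr p"
      if "\<omega> \<in> space M" "1 \<le> i" for \<omega> i
      using \<theta>_nonneg[OF that(2)] measurable_space[OF W that(1)] by (simp add: powr_mult)
    then have "ennreal (\<Sum>i=1..n (W \<omega>). 1 + (n (W \<omega>) * \<theta> i (W \<omega>)) powr p)
        = of_nat (n (W \<omega>)) + ?g (n (W \<omega>)) * ?S \<omega>" if "\<omega> \<in> space M" for \<omega>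
      using that
      by (simp add: sum_ennreal[symmetric] sum.distrib sum_distrib_left ennreal_mult'[symmetric]
          ennreal_plus[symmetric] ennreal_of_nat_eq_real_of_nat[symmetric] add_nonneg_nonneg sum_nonneg
          ennreal_plus del: sum_ennreal)
    then have "(\<integral>\<^sup>+\<omega>. ennreal (\<Sum>i=1..n (W \<omega>). 1 + (n (W \<omega>) * \<theta> i (W \<omega>)) powr p) \<partial>M)
        = (\<integral>\<^sup>+\<omega>. of_nat (n (W \<omega>)) + ?g (n (W \<omega>)) * ?S \<omega> \<partial>M)"
      by (intro nn_integral_cong)
    also have "\<dots> = (\<integral>\<^sup>+\<omega>. of_nat (n (W \<omega>)) \<partial>M) + (\<integral>\<^sup>+\<omega>. ?g (n (W \<omega>)) * ?S \<omega> \<partial>M)"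
      unfolding n_W[abs_def]
      by (intro nn_integral_add borel_measurable_times_ennreal pp.function_of_N_measurable
          power_sum_meas[unfolded n_W])
    also have "\<dots> < \<infinity>"
      using J_finite pp.size_biased_moment_finite[of p] m_finite
      unfolding marked_W[of ?g] unfolding n_W pp.nn_integral_N by (simp add: ennreal_mult_less_top)
    finally show "(\<integral>\<^sup>+\<omega>. ennreal (\<Sum>i=1..n (W \<omega>). 1 + (n (W \<omega>) * \<theta> i (W \<omega>)) powr p) \<partial>M) < \<infinity>" .
  qed

  have limit: "(\<integral>\<omega>. (\<Sum>i=1..n (W \<omega>). \<theta> i (W \<omega>) powr \<alpha>) \<partial>M)
      = enn2real (cumulative_intensity lam T) * (\<integral>\<omega>. h0 \<omega> (T, V0 \<omega>) powr \<alpha> \<partial>M')"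
  proof -
    have "(\<lambda>\<omega>. \<Sum>i=1..n (W \<omega>). \<theta> i (W \<omega>) powr \<alpha>) \<in> borel_measurable M"
    proof (rule measurable_compose[OF W], intro measurable_random_sum n_meas)
      fix i :: nat assume "1 \<le> i"
      note [measurable] = \<theta>_meas[OF this]
      show "(\<lambda>w. \<theta> i w powr \<alpha>) \<in> borel_measurable ?B" by measurable
    qed
    then have "(\<integral>\<omega>. (\<Sum>i=1..n (W \<omega>). \<theta> i (W \<omega>) powr \<alpha>) \<partial>M)
        = enn2real (\<integral>\<^sup>+\<omega>. 1 * (\<Sum>i=1..n (W \<omega>). ennreal (\<theta> i (W \<omega>) powr \<alpha>)) \<partial>M)"
      by (subst integral_eq_nn_integral) (simp_all add: sum_nonneg)
    \<comment> \<open>With unit weight the size-biased series equals 1 and leaves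
      \<open>J \<alpha>\<close> alone.\<close>
    also have "\<dots> = enn2real (J \<alpha>)"
      unfolding marked_W[of "\<lambda>_. 1"] by (simp add: pp.size_biased_sums)
    also have "\<dots> = enn2real (cumulative_intensity lam T) * (\<integral>\<omega>. h0 \<omega> (T, V0 \<omega>) powr \<alpha> \<partial>M')"
      unfolding J_eq enn2real_mult
      by (subst integral_eq_nn_integral) (simp_all add: h0_meas)
    finally show ?thesis .
  qed

  have "shot_noise X h pts T \<omega> = (\<Sum>i=1..n (W \<omega>). X i \<omega> * \<theta> i (W \<omega>))" for \<omega>
    unfolding shot_noise_def n_W by (intro sum.cong) (simp_all add: \<theta>_W H_def)
  then show ?thesis
    using X.random_weighted_sum_tail[OF X_indep[folded W_def] \<theta>_meas \<theta>_nonneg n_meas p_gt integrable]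
    unfolding limit X.tail_def by simp
qed

end
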